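(* Let $X$ be a skip-free Hunt process on $E$ (setting in the context). There exists a continuous, strictly increasing, real-valued function $\mathbf s$ on $E$ such that for all $a,x,b\in E$ with $a<x<b$, $$\mathbf P_x(T_b<T_a)=\frac{\mathbf s(x)-\mathbf s(a)}{\mathbf s(b)-\mathbf s(a)}.$$ If $\tilde{\mathbf s}$ is another function with the same properties, then $\tilde{\mathbf s}=\alpha\mathbf s+\beta$ for some $\alpha>0$ and $\beta\in\mathbb R$.
   Context: Let $E\subset[-\infty,\infty]$ with $l:=\inf E$, $r:=\sup E$, such that $E\cup\{l,r\}$ is closed in $[-\infty,\infty]$. Adjoin a cemetery $\partial$: an extra isolated point if $l,r\in E$; identified with $l$ (resp. $r$) if exactly $l$ (resp. $r$) is missing from $E$; the one-point compactification point if $l,r\notin E$. A skip-free Hunt process on $E$ is a Hunt process $X=(\Omega,\mathscr F_t,\theta_t,X_t,\mathbf P_x,\zeta)$ on $E\cup\{\partial\}$ with lifetime $\zeta$ such that: (SF) for every $x\in E$, $\mathbf P_x$-a.s., $(X_{t-}\wedge X_t,\,X_{t-}\vee X_t)\cap E=\emptyset$ for all $t<\zeta$; (SR) $\mathbf P_x(T_y<\infty)>0$ for all $x,y\in E$, where $T_y:=\inf\{t>0:X_t=y\}$; (SK) if $\mathbf P_x(\zeta<\infty)>0$ for some $x\in E$, then $l\notin E$ or $r\notin E$, and $\mathbf P_x(X_{\zeta-}\notin E,\zeta<\infty)=\mathbf P_x(\zeta<\infty)$. *)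

theory Defs
  imports "HOL-Probability.Probability"
begin

text \<open>States are elements of type ereal option: Some x for x in E, and None for the
cemetery point.  The topology on E plus the cemetery: a set U is open iff its trace on E
is relatively open in E (as a subspace of the extended reals), and, if U contains the
cemetery, then U contains V intersected with E for some open V of the extended reals
containing the missing endpoints (those of inf E, sup E not in E).  This realises
uniformly: an isolated extra point (both endpoints in E), the identification with the
missing endpoint (exactly one missing), and the one-point compactification (both
missing).\<close>

definition cem_open :: "ereal set \<Rightarrow> ereal option set \<Rightarrow> bool" where
  "cem_open E U \<longleftrightarrow>
     U \<subseteq> Some ` E \<union> {None} \<and>
     (\<exists>V. open V \<and> Some -` U = V \<inter> E) \<and>
     (None \<in> U \<longrightarrow>
        (\<exists>V. open V \<and> {Inf E, Sup E} - E \<subseteq> V \<and> V \<inter> E \<subseteq> Some -` U))"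

definition Etop :: "ereal set \<Rightarrow> ereal option topology" where
  "Etop E = topology (cem_open E)"

definition Eborel :: "ereal set \<Rightarrow> ereal option measure" where
  "Eborel E = sigma (topspace (Etop E)) {U. openin (Etop E) U}"

text \<open>Value in the extended reals of a state: the cemetery is read as the missing
endpoint it is identified with (only relevant when some endpoint is missing).\<close>

definition sval :: "ereal set \<Rightarrow> ereal option \<Rightarrow> ereal" where
  "sval E z = (case z of Some y \<Rightarrow> y
                 | None \<Rightarrow> (if Inf E \<notin> E then Inf E else Sup E))"

definition lifetime :: "(real \<Rightarrow> 'w \<Rightarrow> ereal option) \<Rightarrow> 'w \<Rightarrow> ennreal" where
  "lifetime X \<omega> = (INF t \<in> {t. 0 \<le> t \<and> X t \<omega> = None}. ennreal t)"

definition hit :: "(real \<Rightarrow> 'w \<Rightarrow> ereal option) \<Rightarrow> ereal \<Rightarrow> 'w \<Rightarrow> ennreal" where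
  "hit X y \<omega> = (INF t \<in> {t. 0 < t \<and> X t \<omega> = Some y}. ennreal t)"

definition natural_sets :: "ereal set \<Rightarrow> 'w measure \<Rightarrow> (real \<Rightarrow> 'w \<Rightarrow> ereal option) \<Rightarrow> 'w set set" where
  "natural_sets E M X = sigma_sets (space M)
     {{\<omega> \<in> space M. X t \<omega> \<in> A} | t A. 0 \<le> t \<and> A \<in> sets (Eborel E)}"

definition Pmix :: "('s \<Rightarrow> 'w measure) \<Rightarrow> 's measure \<Rightarrow> 'w set \<Rightarrow> ennreal" where
  "Pmix P \<mu> A = (\<integral>\<^sup>+ x. emeasure (P x) A \<partial>\<mu>)"

definition init_dists :: "ereal set \<Rightarrow> ereal option measure set" where
  "init_dists E = {\<mu>. prob_space \<mu> \<and> sets \<mu> = sets (Eborel E)}"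

definition stopping :: "'w measure \<Rightarrow> (real \<Rightarrow> 'w set set) \<Rightarrow> ('w \<Rightarrow> ennreal) \<Rightarrow> bool" where
  "stopping M Ft T \<longleftrightarrow> (\<forall>t\<ge>0. {\<omega> \<in> space M. T \<omega> \<le> ennreal t} \<in> Ft t)"

definition stopped_sets :: "'w measure \<Rightarrow> (real \<Rightarrow> 'w set set) \<Rightarrow> ('w \<Rightarrow> ennreal) \<Rightarrow> 'w set set" where
  "stopped_sets M Ft T = {A \<in> sets M. \<forall>t\<ge>0. {\<omega> \<in> A. T \<omega> \<le> ennreal t} \<in> Ft t}"

text \<open>A Hunt process on E with cemetery (Fukushima--Oshima--Takeda, App. A.2):
  M is the measurable space (Omega, F); P z the law started at state z;
  X t the state at time t; theta t the shift; Ft t the filtration.\<close>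

definition Hunt_process ::
  "ereal set \<Rightarrow> 'w measure \<Rightarrow> (ereal option \<Rightarrow> 'w measure) \<Rightarrow> (real \<Rightarrow> 'w \<Rightarrow> ereal option)
   \<Rightarrow> (real \<Rightarrow> 'w \<Rightarrow> 'w) \<Rightarrow> (real \<Rightarrow> 'w set set) \<Rightarrow> bool" where
  "Hunt_process E M P X \<theta> Ft \<longleftrightarrow>
    (let T = Etop E; S = topspace (Etop E); F0 = natural_sets E M X in
    \<comment> \<open>laws\<close>
    (\<forall>z \<in> S. prob_space (P z) \<and> sets (P z) = sets M) \<and>
    (\<forall>B \<in> F0. (\<lambda>z. emeasure (P z) B) \<in> borel_measurable (Eborel E)) \<and>
    \<comment> \<open>universal completeness of F\<close>
    (\<forall>A. A \<subseteq> space M \<and> (\<forall>\<mu> \<in> init_dists E. \<exists>B \<in> F0. \<exists>N \<in> F0.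
          (A - B) \<union> (B - A) \<subseteq> N \<and> Pmix P \<mu> N = 0) \<longrightarrow> A \<in> sets M) \<and>
    \<comment> \<open>filtration: increasing, right-continuous, augmented, adapted\<close>
    (\<forall>s t. 0 \<le> s \<and> s \<le> t \<longrightarrow> Ft s \<subseteq> Ft t) \<and>
    (\<forall>t\<ge>0. sigma_algebra (space M) (Ft t) \<and> Ft t \<subseteq> sets M) \<and>
    (\<forall>t\<ge>0. Ft t = (\<Inter>s \<in> {t<..}. Ft s)) \<and>
    (\<forall>t\<ge>0. \<forall>A \<in> sets M. (\<forall>\<mu> \<in> init_dists E. \<exists>B \<in> Ft t. \<exists>N \<in> F0.
          (A - B) \<union> (B - A) \<subseteq> N \<and> Pmix P \<mu> N = 0) \<longrightarrow> A \<in> Ft t) \<and>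
    (\<forall>t\<ge>0. X t \<in> measurable (sigma (space M) (Ft t)) (Eborel E)) \<and>
    \<comment> \<open>normality\<close>
    (\<forall>z \<in> S. AE \<omega> in P z. X 0 \<omega> = z) \<and>
    \<comment> \<open>shift operators\<close>
    (\<forall>t\<ge>0. \<theta> t \<in> space M \<rightarrow> space M) \<and>
    (\<forall>\<omega> \<in> space M. \<forall>s\<ge>0. \<forall>t\<ge>0. X s (\<theta> t \<omega>) = X (s + t) \<omega>) \<and>
    \<comment> \<open>paths: in the state space, cemetery absorbing, right-continuous with left limits\<close>
    (\<forall>\<omega> \<in> space M.
       (\<forall>t\<ge>0. X t \<omega> \<in> S) \<and>
       (\<forall>s t. 0 \<le> s \<and> s \<le> t \<and> X s \<omega> = None \<longrightarrow> X t \<omega> = None) \<and>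
       (\<forall>t\<ge>0. limitin T (\<lambda>s. X s \<omega>) (X t \<omega>) (at_right t)) \<and>
       (\<forall>t>0. \<exists>z. limitin T (\<lambda>s. X s \<omega>) z (at_left t))) \<and>
    \<comment> \<open>strong Markov property\<close>
    (\<forall>z \<in> S. \<forall>\<tau>. stopping M Ft \<tau> \<longrightarrow> (\<forall>A \<in> stopped_sets M Ft \<tau>. \<forall>B \<in> F0.
        {\<omega> \<in> A. \<tau> \<omega> < \<infinity> \<and> \<theta> (enn2real (\<tau> \<omega>)) \<omega> \<in> B} \<in> sets M \<and>
        emeasure (P z) {\<omega> \<in> A. \<tau> \<omega> < \<infinity> \<and> \<theta> (enn2real (\<tau> \<omega>)) \<omega> \<in> B} =
        (\<integral>\<^sup>+ \<omega>. indicator {\<omega> \<in> A. \<tau> \<omega> < \<infinity>} \<omega> *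
                 emeasure (P (X (enn2real (\<tau> \<omega>)) \<omega>)) B \<partial>P z))) \<and>
    \<comment> \<open>quasi-left-continuity on [0, infinity)\<close>
    (\<forall>z \<in> S. \<forall>\<tau>s \<tau>. (\<forall>n. stopping M Ft (\<tau>s n)) \<and> (\<forall>\<omega>. incseq (\<lambda>n. \<tau>s n \<omega>)) \<and>
        (\<forall>\<omega>. \<tau> \<omega> = (SUP n. \<tau>s n \<omega>)) \<longrightarrow>
        (AE \<omega> in P z. \<tau> \<omega> < \<infinity> \<longrightarrow>
           limitin T (\<lambda>n. X (enn2real (\<tau>s n \<omega>)) \<omega>) (X (enn2real (\<tau> \<omega>)) \<omega>) sequentially)))"

definition skip_free_Hunt ::
  "ereal set \<Rightarrow> 'w measure \<Rightarrow> (ereal option \<Rightarrow> 'w measure) \<Rightarrow> (real \<Rightarrow> 'w \<Rightarrow> ereal option)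
   \<Rightarrow> (real \<Rightarrow> 'w \<Rightarrow> 'w) \<Rightarrow> (real \<Rightarrow> 'w set set) \<Rightarrow> bool" where
  "skip_free_Hunt E M P X \<theta> Ft \<longleftrightarrow>
    Hunt_process E M P X \<theta> Ft \<and>
    \<comment> \<open>(SF)\<close>
    (\<forall>x \<in> E. AE \<omega> in P (Some x). \<forall>t. 0 < t \<and> ennreal t < lifetime X \<omega> \<longrightarrow>
        (\<forall>z. limitin (Etop E) (\<lambda>s. X s \<omega>) z (at_left t) \<longrightarrow>
           {min (sval E z) (sval E (X t \<omega>)) <..< max (sval E z) (sval E (X t \<omega>))} \<inter> E = {})) \<and>
    \<comment> \<open>(SR)\<close>
    (\<forall>x \<in> E. \<forall>y \<in> E. measure (P (Some x)) {\<omega> \<in> space M. hit X y \<omega> < \<infinity>} > 0) \<and>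
    \<comment> \<open>(SK)\<close>
    ((\<exists>x \<in> E. measure (P (Some x)) {\<omega> \<in> space M. lifetime X \<omega> < \<infinity>} > 0) \<longrightarrow>
       (Inf E \<notin> E \<or> Sup E \<notin> E) \<and>
       (\<forall>x \<in> E. AE \<omega> in P (Some x). lifetime X \<omega> < \<infinity> \<longrightarrow>
          (\<forall>z. limitin (Etop E) (\<lambda>s. X s \<omega>) z (at_left (enn2real (lifetime X \<omega>)))
                \<longrightarrow> z \<notin> Some ` E)))"

definition is_scale :: "ereal set \<Rightarrow> 'w measure \<Rightarrow> (ereal option \<Rightarrow> 'w measure)
   \<Rightarrow> (real \<Rightarrow> 'w \<Rightarrow> ereal option) \<Rightarrow> (ereal \<Rightarrow> real) \<Rightarrow> bool" where
  "is_scale E M P X s \<longleftrightarrow>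
     continuous_on E s \<and> strict_mono_on E s \<and>
     (\<forall>a \<in> E. \<forall>x \<in> E. \<forall>b \<in> E. a < x \<and> x < b \<longrightarrow>
        measure (P (Some x)) {\<omega> \<in> space M. hit X b \<omega> < hit X a \<omega>} =
          (s x - s a) / (s b - s a))"

end

theory Submission
  imports Defs
begin

text \<open>For \<open>y\<close> different from the starting point, \<open>T\<^sub>y\<close> almost surely equals the supremum of the entry times
  into a decreasing base of neighbourhoods of \<open>y\<close>, by quasi-left-continuity.  These entry times are
  measurable for the sigma-algebra generated by the path, so no capacity argument is needed.  Since the process does not
  skip over states, it passes from one side of \<open>y\<close> to the other only through \<open>y\<close>, and the strong
  Markov property gives \<open>P\<^sub>x(T\<^sub>z < T\<^sub>a) = P\<^sub>x(T\<^sub>y < T\<^sub>a) P\<^sub>y(T\<^sub>z < T\<^sub>a)\<close> whenever \<open>a, x, y, z\<close> are in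
  monotone order.  The exit time of \<open>(a, b)\<close> is finite because the process cannot be killed inside
  and \<open>P\<^sub>z(T\<^sub>b \<le> t) \<ge> P\<^sub>a(T\<^sub>b \<le> t)\<close> for \<open>a < z < b\<close>.  So the functions \<open>x \<mapsto> P\<^sub>x(T\<^sub>b < T\<^sub>a)\<close> on different
  intervals \<open>[a, b]\<close> are affinely related and glue to a scale function.  It is continuous because
  \<open>T\<^sub>y\<^sub>n\<close> increases to \<open>T\<^sub>c\<close> as \<open>y\<^sub>n \<rightarrow> c\<close> monotonically, again by quasi-left-continuity.\<close>

section \<open>The state space\<close>

text \<open>The strong Markov property is assumed only for future events in the sigma-algebra
  generated by the path, and events defined through \<open>hit\<close> need not lie in it. All
  computations therefore use limits of entry times, and universal completeness of \<open>M\<close>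
  enters only in the translation back to \<open>hit\<close>. A second obstacle: (SR) makes it
  possible to reach b from x, but not to reach b before a. The strict monotonicity of the scale
  function needs the latter, and it is obtained by counting the time that a detour through a costs.
  The gluing rests on two products. Enlarging an interval to the right multiplies the probability of
  leaving at the right end by a constant; enlarging it to the left multiplies the complementary
  probability by a constant. Both changes are affine in the starting point, so normalising at two
  reference points removes them. Uniqueness is a statement about functions alone: two candidates
  have the same cross-ratios on all triples of \<open>E\<close>, and these determine a strictly
  increasing function up to an affine map.\<close>

lemma cem_openI:
  assumes "U \<subseteq> Some ` E \<union> {None}" "open V" "Some -` U = V \<inter> E"
    and "None \<in> U \<Longrightarrow> \<exists>V. open V \<and> {Inf E, Sup E} - E \<subseteq> V \<and> V \<inter> E \<subseteq> Some -` U"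
  shows "cem_open E U"
  using assms unfolding cem_open_def by blast

lemma cem_open_subset: "cem_open E U \<Longrightarrow> U \<subseteq> Some ` E \<union> {None}"
  unfolding cem_open_def by (elim conjE)

lemma cem_open_trace:
  assumes "cem_open E U"
  obtains V where "open V" "Some -` U = V \<inter> E"
  using assms unfolding cem_open_def by (elim conjE exE)

lemma cem_open_None:
  assumes "cem_open E U" "None \<in> U"
  obtains V where "open V" "{Inf E, Sup E} - E \<subseteq> V" "V \<inter> E \<subseteq> Some -` U"
  using assms unfolding cem_open_def by metis

lemma istopology_cem_open: "istopology (cem_open E)"
  unfolding istopology_def
proof (intro conjI allI impI)
  fix U W assume U: "cem_open E U" and W: "cem_open E W"
  obtain V where V: "open V" "Some -` U = V \<inter> E"
    using U by (rule cem_open_trace)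
  obtain V' where V': "open V'" "Some -` W = V' \<inter> E"
    using W by (rule cem_open_trace)
  have "\<exists>V. open V \<and> {Inf E, Sup E} - E \<subseteq> V \<and> V \<inter> E \<subseteq> Some -` (U \<inter> W)" if "None \<in> U \<inter> W"
  proof -
    from that have "None \<in> U" "None \<in> W" by simp_all
    obtain V1 where "open V1" "{Inf E, Sup E} - E \<subseteq> V1" "V1 \<inter> E \<subseteq> Some -` U"
      using U \<open>None \<in> U\<close> by (rule cem_open_None)
    moreover obtain V2 where "open V2" "{Inf E, Sup E} - E \<subseteq> V2" "V2 \<inter> E \<subseteq> Some -` W"
      using W \<open>None \<in> W\<close> by (rule cem_open_None)
    ultimately show ?thesis
      by (intro exI[of _ "V1 \<inter> V2"] conjI open_Int) auto
  qed
  moreover have "open (V \<inter> V')" "Some -` (U \<inter> W) = (V \<inter> V') \<inter> E"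
    using V V' by auto
  ultimately show "cem_open E (U \<inter> W)"
    using cem_open_subset[OF U] by (intro cem_openI[of "U \<inter> W" E "V \<inter> V'"]) (blast | assumption)+
next
  fix \<K> assume K: "\<forall>K\<in>\<K>. cem_open E K"
  then have "\<forall>K\<in>\<K>. \<exists>V. open V \<and> Some -` K = V \<inter> E"
    by (meson cem_open_trace)
  then obtain V where V: "\<And>K. K \<in> \<K> \<Longrightarrow> open (V K)" "\<And>K. K \<in> \<K> \<Longrightarrow> Some -` K = V K \<inter> E"
    by metis
  have 1: "open (\<Union>(V ` \<K>))" "Some -` (\<Union>\<K>) = \<Union>(V ` \<K>) \<inter> E"
    using V by (auto simp: vimage_Union)
  have 2: "\<exists>V. open V \<and> {Inf E, Sup E} - E \<subseteq> V \<and> V \<inter> E \<subseteq> Some -` (\<Union>\<K>)" if none: "None \<in> \<Union>\<K>"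
  proof -
    from none obtain K where K1: "K \<in> \<K>" "None \<in> K" by blast
    then obtain V where "open V" "{Inf E, Sup E} - E \<subseteq> V" "V \<inter> E \<subseteq> Some -` K"
      using K cem_open_None by metis
    with K1 show ?thesis by (intro exI[of _ V]) auto
  qed
  have 3: "\<Union>\<K> \<subseteq> Some ` E \<union> {None}"
    using K cem_open_subset by blast
  show "cem_open E (\<Union>\<K>)"
    by (rule cem_openI[OF 3 1 2])
qed

lemma openin_Etop: "openin (Etop E) U \<longleftrightarrow> cem_open E U"
  unfolding Etop_def by (simp add: topology_inverse'[OF istopology_cem_open])

lemma topspace_Etop: "topspace (Etop E) = Some ` E \<union> {None}"
proof
  show "topspace (Etop E) \<subseteq> Some ` E \<union> {None}"
    unfolding topspace_def openin_Etop using cem_open_subset by blast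
  have "cem_open E (Some ` E \<union> {None})"
    by (intro cem_openI[of _ _ UNIV] exI[of _ UNIV]) auto
  then show "Some ` E \<union> {None} \<subseteq> topspace (Etop E)"
    unfolding topspace_def openin_Etop by blast
qed

lemma openin_Etop_Some: "open V \<Longrightarrow> openin (Etop E) (Some ` (E \<inter> V))"
  unfolding openin_Etop by (rule cem_openI[of _ _ V]) auto

lemma openin_Etop_None:
  "open V \<Longrightarrow> {Inf E, Sup E} - E \<subseteq> V \<Longrightarrow> openin (Etop E) (insert None (Some ` (E \<inter> V)))"
  unfolding openin_Etop by (rule cem_openI[of _ _ V]) auto

text \<open>A neighbourhood of the cemetery has to surround every missing endpoint, so
  \<open>y\<close> is separated from both at once; an endpoint that lies in \<open>E\<close> imposes
  no condition.\<close>

lemma Etop_separate_None: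
  fixes E :: "ereal set"
  assumes "y \<in> E"
  shows "\<exists>V W. open V \<and> open W \<and> y \<in> V \<and> {Inf E, Sup E} - E \<subseteq> W \<and> V \<inter> W = {}"
proof -
  have "\<exists>V W. open V \<and> open W \<and> y \<in> V \<and> {e} - E \<subseteq> W \<and> V \<inter> W = {}" for e
  proof (cases "e \<in> E")
    case True
    then show ?thesis by (intro exI[of _ UNIV] exI[of _ "{}"]) auto
  next
    case False
    with assms have "y \<noteq> e" by blast
    then show ?thesis using separation_t2[of y e] by blast
  qed
  note sep = this
  obtain V1 W1 where 1: "open V1" "open W1" "y \<in> V1" "{Inf E} - E \<subseteq> W1" "V1 \<inter> W1 = {}"
    using sep by metis
  obtain V2 W2 where 2: "open V2" "open W2" "y \<in> V2" "{Sup E} - E \<subseteq> W2" "V2 \<inter> W2 = {}"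
    using sep by metis
  show ?thesis
  proof (intro exI conjI)
    show "open (V1 \<inter> V2)" "open (W1 \<union> W2)" using 1 2 by (simp_all add: open_Int open_Un)
    show "y \<in> V1 \<inter> V2" using 1(3) 2(3) by simp
    show "{Inf E, Sup E} - E \<subseteq> W1 \<union> W2" using 1(4) 2(4) by blast
    show "(V1 \<inter> V2) \<inter> (W1 \<union> W2) = {}" using 1(5) 2(5) by blast
  qed
qed

lemma Hausdorff_Etop: "Hausdorff_space (Etop E)"
proof -
  have *: "\<exists>U W. openin (Etop E) U \<and> openin (Etop E) W \<and> Some y \<in> U \<and> None \<in> W \<and> disjnt U W"
    if y: "y \<in> E" for y
  proof -
    obtain V W where "open V" "open W" "y \<in> V" "{Inf E, Sup E} - E \<subseteq> W" "V \<inter> W = {}"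
      using Etop_separate_None[OF y] by (elim exE conjE)
    then show ?thesis using y
      by (intro exI[of _ "Some ` (E \<inter> V)"] exI[of _ "insert None (Some ` (E \<inter> W))"])
        (intro conjI openin_Etop_Some openin_Etop_None; auto simp: disjnt_def)
  qed
  have **: "\<exists>U W. openin (Etop E) U \<and> openin (Etop E) W \<and> Some y \<in> U \<and> Some z \<in> W \<and> disjnt U W"
    if y: "y \<in> E" "z \<in> E" "y \<noteq> z" for y z
  proof -
    obtain V W where "open V" "open W" "y \<in> V" "z \<in> W" "V \<inter> W = {}"
      using separation_t2[of y z] y by blast
    then show ?thesis using y
      by (intro exI[of _ "Some ` (E \<inter> V)"] exI[of _ "Some ` (E \<inter> W)"])
        (intro conjI openin_Etop_Some; auto simp: disjnt_def)
  qed
  show ?thesis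
    unfolding Hausdorff_space_def topspace_Etop
  proof (intro allI impI, elim conjE)
    fix u v assume "u \<in> Some ` E \<union> {None}" "v \<in> Some ` E \<union> {None}" "u \<noteq> v"
    then consider y z where "u = Some y" "v = Some z" "y \<in> E" "z \<in> E" "y \<noteq> z"
      | y where "u = Some y" "v = None" "y \<in> E" | y where "v = Some y" "u = None" "y \<in> E"
      by auto
    then show "\<exists>U V. openin (Etop E) U \<and> openin (Etop E) V \<and> u \<in> U \<and> v \<in> V \<and> disjnt U V"
    proof cases
      case 1 then show ?thesis using ** by simp
    next
      case 2 then show ?thesis using * by simp
    next
      case 3 then show ?thesis using *[of y] by (metis disjnt_sym)
    qed
  qed
qed

section \<open>Countable neighbourhood bases\<close>

definition nbh_base :: "ereal set \<Rightarrow> ereal option \<Rightarrow> (nat \<Rightarrow> ereal option set) \<Rightarrow> bool" where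
  "nbh_base E c U \<longleftrightarrow> (\<forall>n. openin (Etop E) (U n) \<and> c \<in> U n) \<and> decseq U \<and>
     (\<forall>G. openin (Etop E) G \<and> c \<in> G \<longrightarrow> (\<exists>n. U n \<subseteq> G))"

lemma ereal_nbh_base:
  fixes e :: ereal
  obtains A :: "nat \<Rightarrow> ereal set"
  where "\<And>n. open (A n)" "\<And>n. e \<in> A n" "decseq A" "\<And>G. open G \<Longrightarrow> e \<in> G \<Longrightarrow> \<exists>n. A n \<subseteq> G"
proof -
  obtain A :: "nat \<Rightarrow> ereal set" where A: "\<And>i. open (A i)" "\<And>i. e \<in> A i"
    "\<And>S. open S \<Longrightarrow> e \<in> S \<Longrightarrow> eventually (\<lambda>i. A i \<subseteq> S) sequentially"
    using countable_basis_at_decseq[of e] by blast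
  show thesis
  proof
    show "open (\<Inter>i\<le>n. A i)" for n using A by auto
    show "e \<in> (\<Inter>i\<le>n. A i)" for n using A by auto
    show "decseq (\<lambda>n. \<Inter>i\<le>n. A i)" by (auto simp: decseq_def)
    show "\<exists>n. (\<Inter>i\<le>n. A i) \<subseteq> G" if "open G" "e \<in> G" for G
      using A(3)[OF that] by (fastforce simp: eventually_sequentially)
  qed
qed

lemma nbh_base_exists:
  assumes "c \<in> topspace (Etop E)"
  shows "\<exists>U. nbh_base E c U"
proof (cases c)
  case (Some y)
  with assms have y: "y \<in> E" by (auto simp: topspace_Etop)
  obtain A where A: "\<And>n. open (A n)" "\<And>n. y \<in> A n" "decseq A"
      "\<And>G. open G \<Longrightarrow> y \<in> G \<Longrightarrow> \<exists>n. A n \<subseteq> G"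
    using ereal_nbh_base by blast
  have "\<exists>n. Some ` (E \<inter> A n) \<subseteq> G" if G: "openin (Etop E) G" "Some y \<in> G" for G
  proof -
    obtain V where V: "open V" "Some -` G = V \<inter> E"
      using G(1) unfolding openin_Etop by (rule cem_open_trace)
    with G y have "y \<in> V" by blast
    with A(4)[of V] V show ?thesis by blast
  qed
  moreover have "decseq (\<lambda>n. Some ` (E \<inter> A n))"
    using A(3) by (fastforce simp: decseq_def)
  ultimately show ?thesis
    unfolding nbh_base_def Some using A y
    by (intro exI[of _ "\<lambda>n. Some ` (E \<inter> A n)"]) (auto intro: openin_Etop_Some)
next
  case None
  \<comment> \<open>For an endpoint in \<open>E\<close> the set \<open>{e} - E\<close> is empty and
    empty neighbourhoods serve, so both endpoints are handled alike and a base at the cemetery is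
    the union of the two sequences.\<close>
  have "\<exists>B. (\<forall>n. open (B n) \<and> {e} - E \<subseteq> B n) \<and> decseq B \<and>
     (\<forall>G. open G \<and> {e} - E \<subseteq> G \<longrightarrow> (\<exists>n::nat. B n \<subseteq> G))" for e
  proof (cases "e \<in> E")
    case True
    then show ?thesis by (intro exI[of _ "\<lambda>n. {}"]) (auto simp: decseq_def)
  next
    case False
    obtain A where A: "\<And>n. open (A n)" "\<And>n. e \<in> A n" "decseq A"
      "\<And>G. open G \<Longrightarrow> e \<in> G \<Longrightarrow> \<exists>n. A n \<subseteq> G"
      using ereal_nbh_base by blast
    then show ?thesis using False by (intro exI[of _ A]) auto
  qed
  note missing = this
  obtain B where B: "\<And>n. open (B n)" "\<And>n. {Inf E} - E \<subseteq> B n" "decseq B"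
       "\<And>G. open G \<Longrightarrow> {Inf E} - E \<subseteq> G \<Longrightarrow> \<exists>n::nat. B n \<subseteq> G"
    using missing by metis
  obtain C where C: "\<And>n. open (C n)" "\<And>n. {Sup E} - E \<subseteq> C n" "decseq C"
       "\<And>G. open G \<Longrightarrow> {Sup E} - E \<subseteq> G \<Longrightarrow> \<exists>n::nat. C n \<subseteq> G"
    using missing by metis
  define U where "U n = insert None (Some ` (E \<inter> (B n \<union> C n)))" for n
  have "\<exists>n. U n \<subseteq> G" if G: "openin (Etop E) G" "None \<in> G" for G
  proof -
    from G obtain V where V: "open V" "{Inf E, Sup E} - E \<subseteq> V" "V \<inter> E \<subseteq> Some -` G"
      unfolding openin_Etop by (metis cem_open_None)
    obtain i j where "B i \<subseteq> V" "C j \<subseteq> V"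
      using B(4)[of V] C(4)[of V] V by blast
    then have "B (max i j) \<subseteq> V" "C (max i j) \<subseteq> V"
      using decseqD[OF B(3), of i "max i j"] decseqD[OF C(3), of j "max i j"] by auto
    with V G show ?thesis by (intro exI[of _ "max i j"]) (auto simp: U_def)
  qed
  moreover have "decseq U"
    unfolding U_def using B(3) C(3) by (fastforce simp: decseq_def)
  moreover have "openin (Etop E) (U n)" for n
    unfolding U_def using B C by (intro openin_Etop_None) blast+
  ultimately show ?thesis
    unfolding nbh_base_def None by (intro exI[of _ U]) (auto simp: U_def)
qed

definition base :: "ereal set \<Rightarrow> ereal option \<Rightarrow> nat \<Rightarrow> ereal option set" where
  "base E c = (SOME U. nbh_base E c U)"

lemma
  assumes "c \<in> topspace (Etop E)"
  shows openin_base: "openin (Etop E) (base E c n)" and mem_base: "c \<in> base E c n"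
    and decseq_base: "decseq (base E c)"
    and base_subset: "openin (Etop E) G \<Longrightarrow> c \<in> G \<Longrightarrow> \<exists>n. base E c n \<subseteq> G"
  using someI_ex[OF nbh_base_exists[OF assms], folded base_def] unfolding nbh_base_def by auto

section \<open>Borel sets of the state space\<close>

lemma space_Eborel: "space (Eborel E) = topspace (Etop E)"
  unfolding Eborel_def by (intro space_measure_of) (auto dest: openin_subset)

lemma openin_sets_Eborel: "openin (Etop E) U \<Longrightarrow> U \<in> sets (Eborel E)"
  unfolding Eborel_def by (subst sets_measure_of) (auto dest: openin_subset)

lemma None_sets_Eborel: "{None} \<in> sets (Eborel E)"
proof -
  have "{None} = space (Eborel E) - Some ` (E \<inter> UNIV)"
    by (auto simp: space_Eborel topspace_Etop)
  then show ?thesis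
    using openin_sets_Eborel[OF openin_Etop_Some[of UNIV E]] by (metis open_UNIV sets.compl_sets)
qed

section \<open>Approach times\<close>

lemma limitin_at_rightD:
  fixes t :: real
  assumes "limitin T f l (at_right t)" "openin T U" "l \<in> U"
  obtains d where "d > 0" "\<And>s. t < s \<Longrightarrow> s < t + d \<Longrightarrow> f s \<in> U"
proof -
  have "eventually (\<lambda>s. f s \<in> U) (at_right t)"
    using assms by (simp add: limitin_def)
  then obtain b where "b > t" "\<And>s. t < s \<Longrightarrow> s < b \<Longrightarrow> f s \<in> U"
    by (auto simp: eventually_at_right_field)
  then show thesis by (intro that[of "b - t"]) auto
qed

lemma limitin_at_leftD:
  fixes t :: real
  assumes "limitin T f l (at_left t)" "openin T U" "l \<in> U"
  obtains d where "d > 0" "\<And>s. t - d < s \<Longrightarrow> s < t \<Longrightarrow> f s \<in> U"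
proof -
  have "eventually (\<lambda>s. f s \<in> U) (at_left t)"
    using assms by (simp add: limitin_def)
  then obtain b where "b < t" "\<And>s. b < s \<Longrightarrow> s < t \<Longrightarrow> f s \<in> U"
    by (auto simp: eventually_at_left_field)
  then show thesis by (intro that[of "t - b"]) auto
qed

locale hunt =
  fixes E :: "ereal set" and M :: "'w measure" and P :: "ereal option \<Rightarrow> 'w measure"
    and X :: "real \<Rightarrow> 'w \<Rightarrow> ereal option" and \<theta> :: "real \<Rightarrow> 'w \<Rightarrow> 'w"
    and Ft :: "real \<Rightarrow> 'w set set"
  assumes hunt: "Hunt_process E M P X \<theta> Ft"
begin

lemmas hunt_conj = hunt[unfolded Hunt_process_def Let_def]

lemmas laws = hunt_conj[THEN conjunct1]
lemmas hunt_from_3 = hunt_conj[THEN conjunct2, THEN conjunct2]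
lemmas complete = hunt_from_3[THEN conjunct1]
lemmas Ft_mono = hunt_from_3[THEN conjunct2, THEN conjunct1]
lemmas Ft_sigma = hunt_from_3[THEN conjunct2, THEN conjunct2, THEN conjunct1]
lemmas Ft_right = hunt_from_3[THEN conjunct2, THEN conjunct2, THEN conjunct2, THEN conjunct1]
lemmas hunt_from_8 = hunt_from_3[THEN conjunct2, THEN conjunct2, THEN conjunct2, THEN conjunct2, THEN conjunct2]
lemmas adapted = hunt_from_8[THEN conjunct1]
lemmas normal = hunt_from_8[THEN conjunct2, THEN conjunct1]
lemmas shift_in = hunt_from_8[THEN conjunct2, THEN conjunct2, THEN conjunct1]
lemmas hunt_from_11 = hunt_from_8[THEN conjunct2, THEN conjunct2, THEN conjunct2]
lemmas shift = hunt_from_11[THEN conjunct1]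
lemmas paths = hunt_from_11[THEN conjunct2, THEN conjunct1]
lemmas strong_Markov = hunt_from_11[THEN conjunct2, THEN conjunct2, THEN conjunct1]
lemmas quasi_left = hunt_from_11[THEN conjunct2, THEN conjunct2, THEN conjunct2]

abbreviation S where "S \<equiv> topspace (Etop E)"

text \<open>Packaged as a measure so that measurability of passage times for the path sigma-algebra
  can be stated; the strong Markov property admits only these sets as future events.\<close>

definition F0 :: "'w measure" where
  "F0 = sigma (space M) {{\<omega> \<in> space M. X t \<omega> \<in> A} | t A. 0 \<le> t \<and> A \<in> sets (Eborel E)}"

lemma space_F0 [simp]: "space F0 = space M"
  unfolding F0_def by (intro space_measure_of) auto

lemma sets_F0: "sets F0 = natural_sets E M X"
  unfolding F0_def natural_sets_def by (intro sets_measure_of) auto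

lemma prob_space_P: "z \<in> S \<Longrightarrow> prob_space (P z)" and sets_P: "z \<in> S \<Longrightarrow> sets (P z) = sets M"
  using laws by auto

lemma space_P: "z \<in> S \<Longrightarrow> space (P z) = space M"
  using sets_P sets_eq_imp_space_eq by blast

lemma path_in: "\<omega> \<in> space M \<Longrightarrow> t \<ge> 0 \<Longrightarrow> X t \<omega> \<in> S"
  using paths by simp

lemma absorbing: "\<omega> \<in> space M \<Longrightarrow> 0 \<le> s \<Longrightarrow> s \<le> t \<Longrightarrow> X s \<omega> = None \<Longrightarrow> X t \<omega> = None"
  using paths by blast

lemma right_cont:
  assumes "\<omega> \<in> space M" "t \<ge> 0" "openin (Etop E) U" "X t \<omega> \<in> U"
  obtains d where "d > 0" "\<And>s. t \<le> s \<Longrightarrow> s < t + d \<Longrightarrow> X s \<omega> \<in> U"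
proof -
  have "limitin (Etop E) (\<lambda>s. X s \<omega>) (X t \<omega>) (at_right t)"
    using paths assms by blast
  then obtain d where "d > 0" "\<And>s. t < s \<Longrightarrow> s < t + d \<Longrightarrow> X s \<omega> \<in> U"
    using limitin_at_rightD[OF _ assms(3,4)] by metis
  then show thesis using assms(4) that[of d] by (metis le_less)
qed

lemma left_limit:
  assumes "\<omega> \<in> space M" "t > 0"
  obtains z where "limitin (Etop E) (\<lambda>s. X s \<omega>) z (at_left t)"
  using paths assms by blast

lemma X_shift: "\<omega> \<in> space M \<Longrightarrow> s \<ge> 0 \<Longrightarrow> t \<ge> 0 \<Longrightarrow> X s (\<theta> t \<omega>) = X (s + t) \<omega>"
  using shift by blast

lemma shift_space: "\<omega> \<in> space M \<Longrightarrow> t \<ge> 0 \<Longrightarrow> \<theta> t \<omega> \<in> space M"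
  using shift_in by blast

lemma Ft_sets: "t \<ge> 0 \<Longrightarrow> A \<in> Ft t \<Longrightarrow> A \<in> sets M"
  using Ft_sigma by blast

lemma Ft_sigma_algebra: "t \<ge> 0 \<Longrightarrow> sigma_algebra (space M) (Ft t)"
  using Ft_sigma by blast

lemma Ft_le: "0 \<le> s \<Longrightarrow> s \<le> t \<Longrightarrow> A \<in> Ft s \<Longrightarrow> A \<in> Ft t"
  using Ft_mono by blast

lemma adapted_sets:
  assumes "t \<ge> 0" "A \<in> sets (Eborel E)"
  shows "{\<omega> \<in> space M. X t \<omega> \<in> A} \<in> Ft t"
proof -
  interpret sigma_algebra "space M" "Ft t" using Ft_sigma_algebra assms(1) .
  have "X t \<in> measurable (sigma (space M) (Ft t)) (Eborel E)"
    using adapted assms by blast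
  from measurable_sets[OF this assms(2)]
  have "X t -` A \<inter> space M \<in> Ft t"
    using space_closed by (simp add: sigma_sets_eq)
  moreover have "X t -` A \<inter> space M = {\<omega> \<in> space M. X t \<omega> \<in> A}" by auto
  ultimately show ?thesis by simp
qed

lemma F0_sets_M: "A \<in> sets F0 \<Longrightarrow> A \<in> sets M"
proof -
  assume A: "A \<in> sets F0"
  have "sigma_sets (space M) {{\<omega> \<in> space M. X t \<omega> \<in> A} | t A. 0 \<le> t \<and> A \<in> sets (Eborel E)} \<subseteq> sets M"
    using adapted_sets Ft_sets by (intro sets.sigma_sets_subset) blast
  with A show "A \<in> sets M"
    unfolding sets_F0 natural_sets_def by blast
qed

lemma X_in_F0: "t \<ge> 0 \<Longrightarrow> A \<in> sets (Eborel E) \<Longrightarrow> {\<omega> \<in> space M. X t \<omega> \<in> A} \<in> sets F0"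
  unfolding sets_F0 natural_sets_def by (auto intro!: sigma_sets.Basic)

section \<open>Entry times and their limits\<close>

definition entry :: "ereal option set \<Rightarrow> real \<Rightarrow> 'w \<Rightarrow> ennreal" where
  "entry U q \<omega> = (INF t \<in> {t. q \<le> t \<and> X t \<omega> \<in> U}. ennreal t)"

text \<open>The start \<open>q\<close> varies because \<open>hit\<close> excludes time
  \<open>0\<close>: off a null set, \<open>hit\<close> is the infimum of \<open>approach\<close>
  over the positive rational \<open>q\<close>.\<close>

definition approach :: "ereal option \<Rightarrow> real \<Rightarrow> 'w \<Rightarrow> ennreal" where
  "approach c q \<omega> = (SUP n. entry (base E c n) q \<omega>)"

lemma entry_le: "q \<le> t \<Longrightarrow> X t \<omega> \<in> U \<Longrightarrow> entry U q \<omega> \<le> ennreal t"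
  unfolding entry_def by (rule INF_lower) simp

lemma entry_ge: "ennreal q \<le> entry U q \<omega>"
  unfolding entry_def by (rule INF_greatest) (simp add: ennreal_leI)

text \<open>After a visit to the open set \<open>U\<close> the path stays there for a while by
  right-continuity, so some rational time, still before \<open>a\<close>, witnesses the visit. Entry
  times are thereby governed by countably many path events.\<close>

lemma entry_less_iff:
  assumes "\<omega> \<in> space M" "q \<ge> 0" "openin (Etop E) U"
  shows "entry U q \<omega> < a \<longleftrightarrow> (\<exists>s\<in>\<rat>. q \<le> s \<and> ennreal s < a \<and> X s \<omega> \<in> U)"
proof
  assume "entry U q \<omega> < a"
  then obtain t where t: "q \<le> t" "X t \<omega> \<in> U" "ennreal t < a"
    unfolding entry_def INF_less_iff by auto
  then obtain d where d: "d > 0" "\<And>s. t \<le> s \<Longrightarrow> s < t + d \<Longrightarrow> X s \<omega> \<in> U"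
    using right_cont[OF assms(1) _ assms(3), of t] assms(2) by auto
  obtain r where r: "r > t" "ennreal r < a"
  proof (cases a)
    case (real b)
    then have "t < b" using t assms(2) by (simp add: ennreal_less_iff)
    then obtain r where "t < r" "r < b" using dense by blast
    with real t assms(2) show thesis by (intro that[of r]) (auto simp: ennreal_less_iff)
  next
    case top
    then show thesis by (intro that[of "t + 1"]) auto
  qed
  obtain s where "s \<in> \<rat>" "t < s" "s < min r (t + d)"
    using Rats_dense_in_real[of t "min r (t + d)"] r d by auto
  moreover from this r have "ennreal s < a"
    using assms(2) t by (intro le_less_trans[OF ennreal_leI r(2)]) auto
  ultimately show "\<exists>s\<in>\<rat>. q \<le> s \<and> ennreal s < a \<and> X s \<omega> \<in> U"
    using d(2)[of s] t by (intro bexI[of _ s]) auto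
next
  assume "\<exists>s\<in>\<rat>. q \<le> s \<and> ennreal s < a \<and> X s \<omega> \<in> U"
  then show "entry U q \<omega> < a" using entry_le le_less_trans by blast
qed

lemma entry_measurable:
  assumes "q \<ge> 0" "openin (Etop E) U"
  shows "entry U q \<in> borel_measurable F0"
proof (rule borel_measurableI_less)
  fix a
  have "{\<omega> \<in> space F0. entry U q \<omega> < a} =
      (\<Union>s\<in>{s\<in>\<rat>. q \<le> s \<and> ennreal s < a}. {\<omega> \<in> space M. X s \<omega> \<in> U})"
    using entry_less_iff[OF _ assms] by auto
  also have "\<dots> \<in> sets F0"
    using assms by (intro sets.countable_UN'' X_in_F0 openin_sets_Eborel)
      (auto intro: countable_subset[OF _ countable_rat])
  finally show "{\<omega> \<in> space F0. entry U q \<omega> < a} \<in> sets F0" .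
qed

text \<open>Rational times before \<open>s\<close> decide only the strict inequality
  \<open>entry U q \<omega> < ennreal s\<close>. Passing to the weak one looks arbitrarily little
  into the future, which right-continuity of the filtration permits.\<close>

lemma entry_stopping:
  assumes "q \<ge> 0" "openin (Etop E) U"
  shows "stopping M Ft (entry U q)"
  unfolding stopping_def
proof (intro allI impI)
  fix t :: real assume t: "t \<ge> 0"
  have less: "{\<omega> \<in> space M. entry U q \<omega> < ennreal s} \<in> Ft s" if "s \<ge> 0" for s
  proof -
    interpret sigma_algebra "space M" "Ft s" using Ft_sigma_algebra that .
    have "{\<omega> \<in> space M. entry U q \<omega> < ennreal s} =
      (\<Union>r\<in>{r\<in>\<rat>. q \<le> r \<and> r < s}. {\<omega> \<in> space M. X r \<omega> \<in> U})"
      using entry_less_iff[OF _ assms] assms(1) by (fastforce simp: ennreal_less_iff)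
    also have "\<dots> \<in> Ft s"
    proof (rule countable_UN')
      show "countable {r\<in>\<rat>. q \<le> r \<and> r < s}"
        by (auto intro: countable_subset[OF _ countable_rat])
      show "(\<lambda>r. {\<omega> \<in> space M. X r \<omega> \<in> U}) ` {r\<in>\<rat>. q \<le> r \<and> r < s} \<subseteq> Ft s"
        using assms by (auto intro!: Ft_le[OF _ _ adapted_sets] openin_sets_Eborel)
    qed
    finally show ?thesis .
  qed
  have "{\<omega> \<in> space M. entry U q \<omega> \<le> ennreal t} \<in> Ft s" if "s > t" for s
  proof -
    interpret sigma_algebra "space M" "Ft s" using Ft_sigma_algebra that t by simp
    define r where "r n = t + (s - t) / real (Suc n)" for n
    have r: "r n > t" "r n \<le> s" for n
    proof -
      show "r n > t" using that by (simp add: r_def)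
      have "(s - t) / real (Suc n) \<le> (s - t) / 1" using that by (intro divide_left_mono) auto
      then show "r n \<le> s" by (simp add: r_def)
    qed
    have lim: "(\<lambda>n. r n) \<longlonglongrightarrow> t"
      unfolding r_def
      using tendsto_add[OF tendsto_const LIMSEQ_Suc[OF lim_const_over_n[of "s - t"]], of t]
      by simp
    have "{\<omega> \<in> space M. entry U q \<omega> \<le> ennreal t} = (\<Inter>n. {\<omega> \<in> space M. entry U q \<omega> < ennreal (r n)})"
    proof (intro set_eqI iffI)
      fix \<omega> assume "\<omega> \<in> {\<omega> \<in> space M. entry U q \<omega> \<le> ennreal t}"
      then show "\<omega> \<in> (\<Inter>n. {\<omega> \<in> space M. entry U q \<omega> < ennreal (r n)})"
        using r t by (auto intro: le_less_trans simp: ennreal_less_iff)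
    next
      fix \<omega> assume *: "\<omega> \<in> (\<Inter>n. {\<omega> \<in> space M. entry U q \<omega> < ennreal (r n)})"
      have "entry U q \<omega> \<le> ennreal t"
      proof (rule tendsto_lowerbound[OF tendsto_ennrealI[OF lim]])
        show "\<forall>\<^sub>F n in sequentially. entry U q \<omega> \<le> ennreal (r n)"
          using * by (intro always_eventually allI less_imp_le) blast
      qed simp
      with * show "\<omega> \<in> {\<omega> \<in> space M. entry U q \<omega> \<le> ennreal t}" by auto
    qed
    also have "\<dots> \<in> Ft s"
    proof (rule countable_INT)
      show "range (\<lambda>n. {\<omega> \<in> space M. entry U q \<omega> < ennreal (r n)}) \<subseteq> Ft s"
        using less r t by (auto intro!: Ft_le[OF _ _ less] simp: less_imp_le order_trans[OF t])
    qed simp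
    finally show ?thesis .
  qed
  then have "{\<omega> \<in> space M. entry U q \<omega> \<le> ennreal t} \<in> (\<Inter>s\<in>{t<..}. Ft s)"
    by blast
  then show "{\<omega> \<in> space M. entry U q \<omega> \<le> ennreal t} \<in> Ft t"
    by (simp only: Ft_right[rule_format, OF t])
qed

lemma entry_incseq:
  assumes "c \<in> S"
  shows "incseq (\<lambda>n. entry (base E c n) q \<omega>)"
proof (rule incseq_SucI)
  fix n
  have "base E c (Suc n) \<subseteq> base E c n" using decseq_base[OF assms] by (simp add: decseq_Suc_iff)
  then show "entry (base E c n) q \<omega> \<le> entry (base E c (Suc n)) q \<omega>"
    unfolding entry_def by (intro INF_superset_mono) auto
qed

lemma approach_measurable:
  assumes "q \<ge> 0" "c \<in> S" shows "approach c q \<in> borel_measurable F0"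
  unfolding approach_def using assms
  by (intro borel_measurable_SUP entry_measurable openin_base) auto

lemma approach_stopping:
  assumes "q \<ge> 0" "c \<in> S" shows "stopping M Ft (approach c q)"
  unfolding stopping_def
proof (intro allI impI)
  fix t :: real assume t: "t \<ge> 0"
  interpret sigma_algebra "space M" "Ft t" using Ft_sigma_algebra t .
  have "{\<omega> \<in> space M. approach c q \<omega> \<le> ennreal t} = (\<Inter>n. {\<omega> \<in> space M. entry (base E c n) q \<omega> \<le> ennreal t})"
    by (auto simp: approach_def SUP_le_iff)
  also have "\<dots> \<in> Ft t"
    using entry_stopping[OF assms(1) openin_base[OF assms(2)]] t
    by (intro countable_INT) (auto simp: stopping_def)
  finally show "{\<omega> \<in> space M. approach c q \<omega> \<le> ennreal t} \<in> Ft t" .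
qed

lemma approach_ge: "ennreal q \<le> approach c q \<omega>"
  unfolding approach_def using entry_ge[of q "base E c 0" \<omega>] by (rule SUP_upper2[rotated]) simp

lemma approach_leI:
  assumes "c \<in> S" "\<And>G. openin (Etop E) G \<Longrightarrow> c \<in> G \<Longrightarrow> \<exists>s. q \<le> s \<and> s \<le> t \<and> X s \<omega> \<in> G"
  shows "approach c q \<omega> \<le> ennreal t"
  unfolding approach_def
proof (rule SUP_least)
  fix n
  obtain s where "q \<le> s" "s \<le> t" "X s \<omega> \<in> base E c n"
    using assms(2)[OF openin_base mem_base] assms(1) by blast
  then show "entry (base E c n) q \<omega> \<le> ennreal t"
    by (meson entry_le ennreal_leI order_trans)
qed

lemma approach_le: "c \<in> S \<Longrightarrow> q \<le> t \<Longrightarrow> X t \<omega> = c \<Longrightarrow> approach c q \<omega> \<le> ennreal t"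
  by (rule approach_leI) auto

text \<open>A left limit at \<open>c\<close> counts as an approach even if the path jumps away at
  that moment. Off \<open>bad\<close>, such a path must have been at \<open>c\<close> no later than
  \<open>t\<close>.\<close>

lemma approach_le_left:
  assumes "c \<in> S" "q < t" "limitin (Etop E) (\<lambda>s. X s \<omega>) c (at_left t)"
  shows "approach c q \<omega> \<le> ennreal t"
proof (rule approach_leI[OF assms(1)])
  fix G assume "openin (Etop E) G" "c \<in> G"
  then obtain d where d: "d > 0" "\<And>s. t - d < s \<Longrightarrow> s < t \<Longrightarrow> X s \<omega> \<in> G"
    using limitin_at_leftD[OF assms(3)] by blast
  have "max q (t - d) < t" using d assms by simp
  then obtain s where "max q (t - d) < s" "s < t" using dense by blast
  with d show "\<exists>s\<ge>q. s \<le> t \<and> X s \<omega> \<in> G" by (intro exI[of _ s]) auto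
qed

section \<open>Paths that approach a state without being there\<close>

definition bad :: "ereal option \<Rightarrow> real \<Rightarrow> 'w set" where
  "bad c q = {\<omega> \<in> space M. approach c q \<omega> < \<infinity> \<and> X (enn2real (approach c q \<omega>)) \<omega> \<noteq> c}"

text \<open>Expresses the position at a random time by countably many conditions at deterministic
  times, which makes \<open>bad\<close> measurable. Times strictly after \<open>t\<close> suffice by
  right-continuity; \<open>max 0\<close> keeps every rational index, also those excluded by the
  premise, among the times at which \<open>X\<close> is known to be measurable.\<close>

lemma X_eq_iff_right:
  assumes "\<omega> \<in> space M" "c \<in> S" "t \<ge> 0"
  shows "X t \<omega> = c \<longleftrightarrow>
    (\<forall>m. \<exists>e. \<forall>s::rat. t < real_of_rat s \<and> real_of_rat s < t + 1 / real (Suc e) \<longrightarrow>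
        X (max 0 (real_of_rat s)) \<omega> \<in> base E c m)"
proof
  assume c: "X t \<omega> = c"
  show "\<forall>m. \<exists>e. \<forall>s::rat. t < real_of_rat s \<and> real_of_rat s < t + 1 / real (Suc e) \<longrightarrow>
        X (max 0 (real_of_rat s)) \<omega> \<in> base E c m"
  proof
    fix m
    obtain d where d: "d > 0" "\<And>s. t \<le> s \<Longrightarrow> s < t + d \<Longrightarrow> X s \<omega> \<in> base E c m"
      using right_cont[OF assms(1,3) openin_base[OF assms(2)]] mem_base[OF assms(2)] c by metis
    obtain e where "inverse (real (Suc e)) < d" using reals_Archimedean d(1) by blast
    moreover have "max 0 (real_of_rat s) = real_of_rat s" if "t < real_of_rat s" for s
      using that assms(3) by linarith
    ultimately show "\<exists>e. \<forall>s::rat. t < real_of_rat s \<and> real_of_rat s < t + 1 / real (Suc e) \<longrightarrow>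
        X (max 0 (real_of_rat s)) \<omega> \<in> base E c m"
      using d(2) by (intro exI[of _ e]) (auto simp: inverse_eq_divide)
  qed
next
  assume *: "\<forall>m. \<exists>e. \<forall>s::rat. t < real_of_rat s \<and> real_of_rat s < t + 1 / real (Suc e) \<longrightarrow>
        X (max 0 (real_of_rat s)) \<omega> \<in> base E c m"
  show "X t \<omega> = c"
  proof (rule ccontr)
    assume "X t \<omega> \<noteq> c"
    then obtain G H where GH: "openin (Etop E) G" "openin (Etop E) H" "X t \<omega> \<in> G" "c \<in> H" "disjnt G H"
      using Hausdorff_Etop path_in[OF assms(1,3)] assms(2) unfolding Hausdorff_space_def by metis
    obtain m where m: "base E c m \<subseteq> H" using base_subset[OF assms(2)] GH by blast
    obtain e where e: "\<And>s::rat. t < real_of_rat s \<Longrightarrow> real_of_rat s < t + 1 / real (Suc e) \<Longrightarrow>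
        X (max 0 (real_of_rat s)) \<omega> \<in> base E c m" using * by blast
    obtain d where d: "d > 0" "\<And>s. t \<le> s \<Longrightarrow> s < t + d \<Longrightarrow> X s \<omega> \<in> G"
      using right_cont[OF assms(1,3) GH(1,3)] by blast
    have "t < min (t + d) (t + 1 / real (Suc e))" using d by simp
    then obtain s where s: "t < real_of_rat s" "real_of_rat s < min (t + d) (t + 1 / real (Suc e))"
      using of_rat_dense by blast
    moreover have "max 0 (real_of_rat s) = real_of_rat s"
      using s(1) assms(3) by linarith
    ultimately have "X (real_of_rat s) \<omega> \<in> G" "X (real_of_rat s) \<omega> \<in> H"
      using d(2)[of "real_of_rat s"] e[of s] m by auto
    with GH show False by (auto simp: disjnt_def)
  qed
qed

lemma bad_F0:
  assumes "q \<ge> 0" "c \<in> S" shows "bad c q \<in> sets F0"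
proof -
  note [measurable] = approach_measurable[OF assms]
  have [measurable]: "Measurable.pred F0 (\<lambda>\<omega>. X (max 0 (real_of_rat s)) \<omega> \<in> base E c m)" for s m
    unfolding pred_def using X_in_F0[OF _ openin_sets_Eborel[OF openin_base[OF assms(2)]], of "max 0 (real_of_rat s)" m]
    by simp
  have "bad c q = {\<omega> \<in> space F0. approach c q \<omega> < \<infinity> \<and> \<not> (\<forall>m. \<exists>e::nat. \<forall>s::rat.
      enn2real (approach c q \<omega>) < real_of_rat s \<and> real_of_rat s < enn2real (approach c q \<omega>) + 1 / real (Suc e) \<longrightarrow>
        X (max 0 (real_of_rat s)) \<omega> \<in> base E c m)}"
    unfolding bad_def space_F0
    by (rule Collect_cong, rule conj_cong[OF refl], subst X_eq_iff_right[OF _ assms(2) enn2real_nonneg])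
      (rule refl | assumption)+
  also have "\<dots> \<in> sets F0" by measurable
  finally show ?thesis .
qed

end

section \<open>Null sets and the strong Markov property\<close>

lemma ennreal_le_INF_add:
  fixes f :: "'a \<Rightarrow> ennreal"
  assumes "\<And>i. i \<in> I \<Longrightarrow> x \<le> ennreal r + f i"
  shows "x \<le> ennreal r + (INF i\<in>I. f i)"
proof -
  have "x - ennreal r \<le> f i" if "i \<in> I" for i
    using assms[OF that] by (simp add: ennreal_minus_le_iff)
  then have "x - ennreal r \<le> (INF i\<in>I. f i)" by (rule INF_greatest)
  then show ?thesis by (simp add: ennreal_minus_le_iff)
qed

text \<open>The order is witnessed by a rational \<open>q\<close> with
  \<open>\<tau> \<le> q < \<sigma>\<close>, and each such event is known at time
  \<open>q\<close>.\<close>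

lemma stopped_less:
  assumes sig: "\<And>t. t \<ge> 0 \<Longrightarrow> sigma_algebra (space M) (Ft t)"
    and sub: "\<And>t A. t \<ge> 0 \<Longrightarrow> A \<in> Ft t \<Longrightarrow> A \<in> sets M"
    and mono: "\<And>s t A. 0 \<le> s \<Longrightarrow> s \<le> t \<Longrightarrow> A \<in> Ft s \<Longrightarrow> A \<in> Ft t"
    and "stopping M Ft \<tau>" "stopping M Ft \<sigma>"
  shows "{\<omega> \<in> space M. \<tau> \<omega> < \<sigma> \<omega>} \<in> stopped_sets M Ft \<tau>"
proof -
  define A where "A t = {\<omega> \<in> space M. \<tau> \<omega> \<le> ennreal t} - {\<omega> \<in> space M. \<sigma> \<omega> \<le> ennreal t}" for t
  have A: "A t \<in> Ft t" if "t \<ge> 0" for t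
  proof -
    interpret sigma_algebra "space M" "Ft t" using sig that .
    show ?thesis unfolding A_def using assms(4,5) that by (auto simp: stopping_def)
  qed
  have *: "\<exists>q\<ge>0. q \<in> \<rat> \<and> \<tau> \<omega> \<le> ennreal q \<and> \<not> \<sigma> \<omega> \<le> ennreal q" if less: "\<tau> \<omega> < \<sigma> \<omega>" for \<omega>
  proof -
    obtain r :: rat where r: "\<tau> \<omega> < ennreal (real_of_rat r)" "ennreal (real_of_rat r) < \<sigma> \<omega>"
      using ennreal_rat_dense[OF less] by blast
    then have "real_of_rat r \<ge> 0" by (metis ennreal_neg linorder_not_le not_less_zero order_less_imp_le)
    with r show ?thesis by (intro exI[of _ "real_of_rat r"]) auto
  qed
  have "{\<omega> \<in> space M. \<tau> \<omega> < \<sigma> \<omega>} = (\<Union>q\<in>{q. 0 \<le> q \<and> q \<in> \<rat>}. A q)"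
    unfolding A_def using * by auto
  also have "\<dots> \<in> sets M"
    using A sub by (intro sets.countable_UN'') (auto intro: countable_subset[OF _ countable_rat])
  finally have 1: "{\<omega> \<in> space M. \<tau> \<omega> < \<sigma> \<omega>} \<in> sets M" .
  have "{\<omega> \<in> {\<omega> \<in> space M. \<tau> \<omega> < \<sigma> \<omega>}. \<tau> \<omega> \<le> ennreal t} \<in> Ft t" if t: "t \<ge> 0" for t
  proof -
    interpret sigma_algebra "space M" "Ft t" using sig t .
    \<comment> \<open>\<open>t\<close> joins the rationals because a rational between the two times
      may exceed \<open>t\<close>; in that case \<open>t\<close> itself separates them.\<close>
    have "{\<omega> \<in> {\<omega> \<in> space M. \<tau> \<omega> < \<sigma> \<omega>}. \<tau> \<omega> \<le> ennreal t} =
        (\<Union>q\<in>{q. 0 \<le> q \<and> q \<le> t \<and> q \<in> insert t \<rat>}. A q)"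
    proof (intro set_eqI iffI)
      fix \<omega> assume "\<omega> \<in> {\<omega> \<in> {\<omega> \<in> space M. \<tau> \<omega> < \<sigma> \<omega>}. \<tau> \<omega> \<le> ennreal t}"
      then have \<omega>: "\<omega> \<in> space M" "\<tau> \<omega> < \<sigma> \<omega>" "\<tau> \<omega> \<le> ennreal t" by auto
      obtain q where q: "q \<ge> 0" "q \<in> \<rat>" "\<tau> \<omega> \<le> ennreal q" "\<not> \<sigma> \<omega> \<le> ennreal q"
        using * \<omega> by blast
      show "\<omega> \<in> (\<Union>q\<in>{q. 0 \<le> q \<and> q \<le> t \<and> q \<in> insert t \<rat>}. A q)"
      proof (cases "q \<le> t")
        case True
        then show ?thesis using q \<omega> by (auto simp: A_def)
      next
        case False
        then have "\<not> \<sigma> \<omega> \<le> ennreal t" using q by (meson ennreal_leI nle_le order_trans)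
        then have "\<omega> \<in> A t" using \<omega> by (auto simp: A_def)
        then show ?thesis using t by blast
      qed
    next
      fix \<omega> assume "\<omega> \<in> (\<Union>q\<in>{q. 0 \<le> q \<and> q \<le> t \<and> q \<in> insert t \<rat>}. A q)"
      then obtain q where "0 \<le> q" "q \<le> t" "\<omega> \<in> A q" by blast
      then show "\<omega> \<in> {\<omega> \<in> {\<omega> \<in> space M. \<tau> \<omega> < \<sigma> \<omega>}. \<tau> \<omega> \<le> ennreal t}"
        using ennreal_leI[of q t] unfolding A_def by (auto intro: order_trans)
    qed
    also have "\<dots> \<in> Ft t"
    proof (rule countable_UN')
      show "countable {q. 0 \<le> q \<and> q \<le> t \<and> q \<in> insert t \<rat>}"
        by (rule countable_subset[of _ "insert t \<rat>"]) (auto simp: countable_rat)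
      show "A ` {q. 0 \<le> q \<and> q \<le> t \<and> q \<in> insert t \<rat>} \<subseteq> Ft t"
        using A mono by blast
    qed
    finally show ?thesis .
  qed
  with 1 show ?thesis unfolding stopped_sets_def by blast
qed

lemma lifetime_le: "0 \<le> t \<Longrightarrow> X t \<omega> = None \<Longrightarrow> lifetime X \<omega> \<le> ennreal t"
  unfolding lifetime_def by (rule INF_lower) simp

context hunt begin

text \<open>The infimum need not be attained, but it is approached from the right, so by
  right-continuity the path at the entry time is in the closure of \<open>U\<close>.\<close>

lemma entry_closure:
  assumes "\<omega> \<in> space M" "q \<ge> 0" "openin (Etop E) G" "entry U q \<omega> < \<infinity>"
    "X (enn2real (entry U q \<omega>)) \<omega> \<in> G"
  shows "G \<inter> U \<noteq> {}"
proof -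
  define t where "t = enn2real (entry U q \<omega>)"
  have t: "entry U q \<omega> = ennreal t" "t \<ge> 0"
    using assms(4) by (auto simp: t_def)
  obtain d where d: "d > 0" "\<And>s. t \<le> s \<Longrightarrow> s < t + d \<Longrightarrow> X s \<omega> \<in> G"
    using right_cont[OF assms(1) t(2) assms(3)] assms(5) unfolding t_def by blast
  have "entry U q \<omega> < ennreal (t + d)" using t d by (simp add: ennreal_less_iff)
  then obtain s where s: "q \<le> s" "X s \<omega> \<in> U" "ennreal s < ennreal (t + d)"
    unfolding entry_def INF_less_iff by auto
  have "ennreal t \<le> ennreal s" using entry_le[OF s(1,2)] t by simp
  then have "t \<le> s" using s(1) assms(2) by simp
  moreover have "s < t + d" using s assms(2) by (simp add: ennreal_less_iff)
  ultimately show ?thesis using d s by blast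
qed

text \<open>Quasi-left-continuity makes the positions at the entry times converge to the position at
  \<open>approach c q\<close>. Each of them is in the closure of the corresponding base set, and
  these sets shrink to \<open>c\<close>, so in a Hausdorff space the limit can only be
  \<open>c\<close>.\<close>

lemma bad_null:
  assumes "q \<ge> 0" "c \<in> S" "z \<in> S"
  shows "bad c q \<in> null_sets (P z)"
proof -
  define e where "e n = entry (base E c n) q" for n
  have "\<And>n. stopping M Ft (e n)" unfolding e_def
    using entry_stopping[OF assms(1) openin_base[OF assms(2)]] .
  moreover have "incseq (\<lambda>n. e n \<omega>)" for \<omega> unfolding e_def using entry_incseq[OF assms(2)] .
  moreover have "approach c q \<omega> = (SUP n. e n \<omega>)" for \<omega> unfolding e_def approach_def ..
  ultimately have "AE \<omega> in P z. approach c q \<omega> < \<infinity> \<longrightarrow>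
      limitin (Etop E) (\<lambda>n. X (enn2real (e n \<omega>)) \<omega>) (X (enn2real (approach c q \<omega>)) \<omega>) sequentially"
    using quasi_left assms(3) by blast
  then have "AE \<omega> in P z. \<omega> \<notin> bad c q"
  proof (rule AE_mp, intro AE_I2 impI)
    fix \<omega> assume "\<omega> \<in> space (P z)" and lim: "approach c q \<omega> < \<infinity> \<longrightarrow>
      limitin (Etop E) (\<lambda>n. X (enn2real (e n \<omega>)) \<omega>) (X (enn2real (approach c q \<omega>)) \<omega>) sequentially"
    then have \<omega>: "\<omega> \<in> space M" using space_P assms(3) by blast
    show "\<omega> \<notin> bad c q"
    proof
      assume "\<omega> \<in> bad c q"
      then have fin: "approach c q \<omega> < \<infinity>" and ne: "X (enn2real (approach c q \<omega>)) \<omega> \<noteq> c"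
        by (auto simp: bad_def)
      obtain G H where GH: "openin (Etop E) G" "openin (Etop E) H"
          "X (enn2real (approach c q \<omega>)) \<omega> \<in> G" "c \<in> H" "disjnt G H"
        using Hausdorff_Etop path_in[OF \<omega> enn2real_nonneg] assms(2) ne
        unfolding Hausdorff_space_def by metis
      obtain m where m: "base E c m \<subseteq> H" using base_subset[OF assms(2)] GH by blast
      have "\<forall>\<^sub>F n in sequentially. X (enn2real (e n \<omega>)) \<omega> \<in> G"
        using lim fin GH unfolding limitin_def by blast
      then obtain k where k: "\<And>n. n \<ge> k \<Longrightarrow> X (enn2real (e n \<omega>)) \<omega> \<in> G"
        by (auto simp: eventually_sequentially)
      define n where "n = max m k"
      have "e n \<omega> \<le> approach c q \<omega>" unfolding e_def approach_def by (rule SUP_upper) simp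
      with fin have "e n \<omega> < \<infinity>" by (simp add: le_less_trans)
      then have "G \<inter> base E c n \<noteq> {}"
        using entry_closure[OF \<omega> assms(1) GH(1), of "base E c n"] k[of n]
        by (simp add: e_def n_def)
      moreover have "base E c n \<subseteq> base E c m"
        using decseqD[OF decseq_base[OF assms(2)]] by (simp add: n_def)
      ultimately show False using m GH(5) by (auto simp: disjnt_def)
    qed
  qed
  then show ?thesis
    using bad_F0[OF assms(1,2)] F0_sets_M sets_P[OF assms(3)] by (subst AE_iff_null_sets) auto
qed

lemma AE_not_bad: "q \<ge> 0 \<Longrightarrow> c \<in> S \<Longrightarrow> z \<in> S \<Longrightarrow> AE \<omega> in P z. \<omega> \<notin> bad c q"
  using bad_null by (rule AE_not_in)

lemma Some_in_S [simp]: "y \<in> E \<Longrightarrow> Some y \<in> S" and None_in_S [simp]: "None \<in> S"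
  by (auto simp: topspace_Etop)

text \<open>Time \<open>0\<close> counts here: the value is \<open>0\<close> on a path that starts
  at \<open>y\<close>, where \<open>hit\<close> need not vanish. The two are compared only for other
  starting points.\<close>

definition passage :: "ereal \<Rightarrow> 'w \<Rightarrow> ennreal" where
  "passage y = approach (Some y) 0"

lemma passage_measurable: "y \<in> E \<Longrightarrow> passage y \<in> borel_measurable F0"
  unfolding passage_def by (rule approach_measurable) auto

lemma passage_stopping: "y \<in> E \<Longrightarrow> stopping M Ft (passage y)"
  unfolding passage_def by (rule approach_stopping) auto

lemma passage_le: "y \<in> E \<Longrightarrow> 0 \<le> t \<Longrightarrow> X t \<omega> = Some y \<Longrightarrow> passage y \<omega> \<le> ennreal t"
  unfolding passage_def by (rule approach_le) auto

lemma stopping_const: "stopping M Ft (\<lambda>_. ennreal e)"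
  unfolding stopping_def
proof (intro allI impI)
  fix t :: real assume t: "t \<ge> 0"
  interpret sigma_algebra "space M" "Ft t" using Ft_sigma_algebra t .
  show "{\<omega> \<in> space M. ennreal e \<le> ennreal t} \<in> Ft t" by (cases "ennreal e \<le> ennreal t") auto
qed

lemma stopped_passage_less:
  "y \<in> E \<Longrightarrow> stopping M Ft \<sigma> \<Longrightarrow> {\<omega> \<in> space M. passage y \<omega> < \<sigma> \<omega>} \<in> stopped_sets M Ft (passage y)"
  by (rule stopped_less[OF Ft_sigma_algebra Ft_sets Ft_le passage_stopping])

lemma stopped_Compl:
  assumes "stopping M Ft \<tau>" "A \<in> stopped_sets M Ft \<tau>"
  shows "space M - A \<in> stopped_sets M Ft \<tau>"
proof -
  have "{\<omega> \<in> space M - A. \<tau> \<omega> \<le> ennreal t} \<in> Ft t" if "t \<ge> 0" for t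
  proof -
    interpret sigma_algebra "space M" "Ft t" using Ft_sigma_algebra that .
    have "{\<omega> \<in> space M - A. \<tau> \<omega> \<le> ennreal t} =
        {\<omega> \<in> space M. \<tau> \<omega> \<le> ennreal t} - {\<omega> \<in> A. \<tau> \<omega> \<le> ennreal t}" by auto
    also have "\<dots> \<in> Ft t" using assms that by (auto simp: stopping_def stopped_sets_def)
    finally show ?thesis .
  qed
  with assms(2) show ?thesis by (auto simp: stopped_sets_def)
qed

lemma stopped_space: "stopping M Ft \<tau> \<Longrightarrow> space M \<in> stopped_sets M Ft \<tau>"
  by (auto simp: stopped_sets_def stopping_def)

lemma strong_Markov_const:
  assumes "z \<in> S" "t \<ge> 0" "A \<in> Ft t" "B \<in> sets F0"
  shows "{\<omega> \<in> A. \<theta> t \<omega> \<in> B} \<in> sets M"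
    and "emeasure (P z) {\<omega> \<in> A. \<theta> t \<omega> \<in> B} =
      (\<integral>\<^sup>+ \<omega>. indicator A \<omega> * emeasure (P (X t \<omega>)) B \<partial>P z)"
proof -
  have "A \<in> stopped_sets M Ft (\<lambda>_. ennreal t)"
  proof -
    have "{\<omega> \<in> A. ennreal t \<le> ennreal s} \<in> Ft s" if "s \<ge> 0" for s
    proof (cases "t \<le> s")
      case True
      then have "{\<omega> \<in> A. ennreal t \<le> ennreal s} = A" using ennreal_leI by simp
      then show ?thesis using Ft_le[OF assms(2) True assms(3)] by simp
    next
      case False
      interpret sigma_algebra "space M" "Ft s" using Ft_sigma_algebra that .
      show ?thesis using False that assms(2) by (simp add: ennreal_le_iff2)
    qed
    then show ?thesis using Ft_sets assms by (auto simp: stopped_sets_def)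
  qed
  note * = strong_Markov[rule_format, OF assms(1) stopping_const this, folded sets_F0, OF assms(4)]
  have **: "{\<omega> \<in> A. ennreal t < \<infinity> \<and> \<theta> (enn2real (ennreal t)) \<omega> \<in> B} = {\<omega> \<in> A. \<theta> t \<omega> \<in> B}"
    "{\<omega> \<in> A. ennreal t < \<infinity>} = A"
    using assms(2) by auto
  show "{\<omega> \<in> A. \<theta> t \<omega> \<in> B} \<in> sets M" using *[THEN conjunct1] unfolding ** .
  show "emeasure (P z) {\<omega> \<in> A. \<theta> t \<omega> \<in> B} =
      (\<integral>\<^sup>+ \<omega>. indicator A \<omega> * emeasure (P (X t \<omega>)) B \<partial>P z)"
    using *[THEN conjunct2] unfolding ** using assms(2) by simp
qed

text \<open>Off the null set \<open>bad (Some y) 0\<close> the process is at \<open>y\<close> at a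
  finite passage time, so the integrand of the strong Markov property is constant and the
  probability factorises.\<close>

lemma strong_Markov_passage:
  assumes "z \<in> S" "y \<in> E" "A \<in> stopped_sets M Ft (passage y)" "B \<in> sets F0"
  shows "{\<omega> \<in> A. passage y \<omega> < \<infinity> \<and> \<theta> (enn2real (passage y \<omega>)) \<omega> \<in> B} \<in> sets M"
    and "measure (P z) {\<omega> \<in> A. passage y \<omega> < \<infinity> \<and> \<theta> (enn2real (passage y \<omega>)) \<omega> \<in> B} =
      measure (P z) {\<omega> \<in> A. passage y \<omega> < \<infinity>} * measure (P (Some y)) B"
proof -
  note * = strong_Markov[rule_format, OF assms(1) passage_stopping[OF assms(2)] assms(3),
      folded sets_F0, OF assms(4)]
  then show "{\<omega> \<in> A. passage y \<omega> < \<infinity> \<and> \<theta> (enn2real (passage y \<omega>)) \<omega> \<in> B} \<in> sets M"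
    by (rule conjunct1)
  have AM: "A \<in> sets M" using assms(3) by (simp add: stopped_sets_def)
  note [measurable] = passage_measurable[OF assms(2)]
  have "{\<omega> \<in> space F0. passage y \<omega> < \<infinity>} \<in> sets F0" by measurable
  then have "{\<omega> \<in> space M. passage y \<omega> < \<infinity>} \<in> sets M"
    unfolding space_F0 by (rule F0_sets_M)
  then have "A \<inter> {\<omega> \<in> space M. passage y \<omega> < \<infinity>} \<in> sets M" using AM by (rule sets.Int[rotated])
  moreover have "A \<inter> {\<omega> \<in> space M. passage y \<omega> < \<infinity>} = {\<omega> \<in> A. passage y \<omega> < \<infinity>}"
    using sets.sets_into_space[OF AM] by auto
  ultimately have A': "{\<omega> \<in> A. passage y \<omega> < \<infinity>} \<in> sets (P z)" using sets_P[OF assms(1)] by simp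
  have "emeasure (P z) {\<omega> \<in> A. passage y \<omega> < \<infinity> \<and> \<theta> (enn2real (passage y \<omega>)) \<omega> \<in> B} =
      (\<integral>\<^sup>+ \<omega>. indicator {\<omega> \<in> A. passage y \<omega> < \<infinity>} \<omega> *
                 emeasure (P (X (enn2real (passage y \<omega>)) \<omega>)) B \<partial>P z)"
    using * by (rule conjunct2)
  also have "\<dots> = (\<integral>\<^sup>+ \<omega>. emeasure (P (Some y)) B * indicator {\<omega> \<in> A. passage y \<omega> < \<infinity>} \<omega> \<partial>P z)"
  proof (rule nn_integral_cong_AE)
    have "AE \<omega> in P z. \<omega> \<notin> bad (Some y) 0" using assms by (intro AE_not_bad) auto
    then show "AE \<omega> in P z. indicator {\<omega> \<in> A. passage y \<omega> < \<infinity>} \<omega> *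
                 emeasure (P (X (enn2real (passage y \<omega>)) \<omega>)) B =
        emeasure (P (Some y)) B * indicator {\<omega> \<in> A. passage y \<omega> < \<infinity>} \<omega>"
    proof (rule AE_mp, intro AE_I2 impI)
      fix \<omega> assume "\<omega> \<in> space (P z)" "\<omega> \<notin> bad (Some y) 0"
      then show "indicator {\<omega> \<in> A. passage y \<omega> < \<infinity>} \<omega> *
                 emeasure (P (X (enn2real (passage y \<omega>)) \<omega>)) B =
        emeasure (P (Some y)) B * indicator {\<omega> \<in> A. passage y \<omega> < \<infinity>} \<omega>"
        using space_P[OF assms(1)] by (auto simp: bad_def passage_def split: split_indicator)
    qed
  qed
  also have "\<dots> = emeasure (P (Some y)) B * emeasure (P z) {\<omega> \<in> A. passage y \<omega> < \<infinity>}"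
    using A' by (rule nn_integral_cmult_indicator)
  finally show "measure (P z) {\<omega> \<in> A. passage y \<omega> < \<infinity> \<and> \<theta> (enn2real (passage y \<omega>)) \<omega> \<in> B} =
      measure (P z) {\<omega> \<in> A. passage y \<omega> < \<infinity>} * measure (P (Some y)) B"
    by (simp add: measure_def enn2real_mult mult.commute)
qed

section \<open>Entry times, passage times and the lifetime under the shift and in time\<close>

lemma entry_shift:
  assumes "\<omega> \<in> space M" "r \<ge> 0" "ennreal r < entry U 0 \<omega>"
  shows "entry U 0 \<omega> = ennreal r + entry U 0 (\<theta> r \<omega>)"
proof (rule antisym)
  show "entry U 0 \<omega> \<le> ennreal r + entry U 0 (\<theta> r \<omega>)"
    unfolding entry_def[of U 0 "\<theta> r \<omega>"]
  proof (rule ennreal_le_INF_add)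
    fix t assume "t \<in> {t. 0 \<le> t \<and> X t (\<theta> r \<omega>) \<in> U}"
    then have "0 \<le> t" "X (t + r) \<omega> \<in> U" using X_shift assms by auto
    then show "entry U 0 \<omega> \<le> ennreal r + ennreal t"
      using entry_le[of 0 "t + r" \<omega> U] assms(2) by (simp add: add.commute)
  qed
  show "ennreal r + entry U 0 (\<theta> r \<omega>) \<le> entry U 0 \<omega>"
    unfolding entry_def[of U 0 \<omega>]
  proof (rule INF_greatest)
    fix t assume "t \<in> {t. 0 \<le> t \<and> X t \<omega> \<in> U}"
    then have t: "0 \<le> t" "X t \<omega> \<in> U" by auto
    then have "ennreal r < ennreal t" using assms(3) entry_le less_le_trans by blast
    then have rt: "r \<le> t" using assms(2) t by (simp add: ennreal_less_iff)
    have "entry U 0 (\<theta> r \<omega>) \<le> ennreal (t - r)"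
      using t rt assms X_shift[OF assms(1), of "t - r" r] by (intro entry_le) auto
    then have "ennreal r + entry U 0 (\<theta> r \<omega>) \<le> ennreal r + ennreal (t - r)" by (rule add_left_mono)
    also have "\<dots> = ennreal t" using rt assms(2) by (simp flip: ennreal_plus)
    finally show "ennreal r + entry U 0 (\<theta> r \<omega>) \<le> ennreal t" .
  qed
qed

text \<open>A time strictly below the supremum is below all entry times from some index on. For
  those the shift identity is exact, and it survives the limit.\<close>

lemma approach_shift:
  assumes "\<omega> \<in> space M" "c \<in> S" "r \<ge> 0" "ennreal r < approach c 0 \<omega>"
  shows "approach c 0 \<omega> = ennreal r + approach c 0 (\<theta> r \<omega>)"
proof -
  obtain n where "ennreal r < entry (base E c n) 0 \<omega>"
    using assms(4) unfolding approach_def less_SUP_iff by blast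
  then have *: "entry (base E c (m + n)) 0 \<omega> = ennreal r + entry (base E c (m + n)) 0 (\<theta> r \<omega>)" for m
    using incseqD[OF entry_incseq[OF assms(2)], of n "m + n" 0 \<omega>]
    by (intro entry_shift assms(1,3)) (auto intro: less_le_trans)
  have lim: "(\<lambda>m. entry (base E c (m + n)) 0 \<omega>) \<longlonglongrightarrow> approach c 0 \<omega>" for \<omega>
    unfolding approach_def by (rule LIMSEQ_ignore_initial_segment[OF LIMSEQ_SUP[OF entry_incseq[OF assms(2)]]])
  have "(\<lambda>m. entry (base E c (m + n)) 0 \<omega>) \<longlonglongrightarrow> ennreal r + approach c 0 (\<theta> r \<omega>)"
    unfolding * by (intro tendsto_add tendsto_const lim)
  then show ?thesis using lim LIMSEQ_unique by blast
qed

lemma passage_shift: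
  "\<omega> \<in> space M \<Longrightarrow> y \<in> E \<Longrightarrow> r \<ge> 0 \<Longrightarrow> ennreal r < passage y \<omega> \<Longrightarrow>
    passage y \<omega> = ennreal r + passage y (\<theta> r \<omega>)"
  unfolding passage_def by (rule approach_shift) auto

lemma less_lifetime:
  assumes "\<omega> \<in> space M" "t \<ge> 0" "X t \<omega> \<noteq> None"
  shows "ennreal t < lifetime X \<omega>"
proof -
  have "X t \<omega> \<in> Some ` (E \<inter> UNIV)" using path_in[OF assms(1,2)] assms(3) by (auto simp: topspace_Etop)
  then obtain d where d: "d > 0" "\<And>s. t \<le> s \<Longrightarrow> s < t + d \<Longrightarrow> X s \<omega> \<in> Some ` (E \<inter> UNIV)"
    using right_cont[OF assms(1,2) openin_Etop_Some[OF open_UNIV]] by blast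
  have "ennreal (t + d) \<le> lifetime X \<omega>"
    unfolding lifetime_def
  proof (rule INF_greatest)
    fix s assume "s \<in> {t. 0 \<le> t \<and> X t \<omega> = None}"
    then have s: "0 \<le> s" "X s \<omega> = None" by auto
    have "\<not> s \<le> t"
    proof
      assume "s \<le> t"
      from absorbing[OF assms(1) s(1) this s(2)] assms(3) show False by contradiction
    qed
    then have "t + d \<le> s" using d(2)[of s] s(2) by fastforce
    then show "ennreal (t + d) \<le> ennreal s" by (rule ennreal_leI)
  qed
  moreover have "ennreal t < ennreal (t + d)" using d assms(2) by (simp add: ennreal_less_iff)
  ultimately show ?thesis by (rule less_le_trans[rotated])
qed

text \<open>The cemetery is absorbing, so it suffices to look at integer times.\<close>

lemma lifetime_finite_F0: "{\<omega> \<in> space M. lifetime X \<omega> < \<infinity>} \<in> sets F0"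
proof -
  have "{\<omega> \<in> space M. lifetime X \<omega> < \<infinity>} = (\<Union>n::nat. {\<omega> \<in> space M. X (real n) \<omega> \<in> {None}})"
  proof (intro set_eqI iffI)
    fix \<omega> assume "\<omega> \<in> {\<omega> \<in> space M. lifetime X \<omega> < \<infinity>}"
    then obtain t where t: "\<omega> \<in> space M" "0 \<le> t" "X t \<omega> = None"
      unfolding lifetime_def INF_less_iff by auto
    obtain n where "t \<le> real n" using real_arch_simple by blast
    then show "\<omega> \<in> (\<Union>n::nat. {\<omega> \<in> space M. X (real n) \<omega> \<in> {None}})"
      using absorbing[OF t(1,2) _ t(3)] t(1) by auto
  next
    fix \<omega> assume "\<omega> \<in> (\<Union>n::nat. {\<omega> \<in> space M. X (real n) \<omega> \<in> {None}})"
    then obtain n where n: "\<omega> \<in> space M" "X (real n) \<omega> = None" by auto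
    then have "lifetime X \<omega> \<le> ennreal (real n)" by (intro lifetime_le) auto
    then show "\<omega> \<in> {\<omega> \<in> space M. lifetime X \<omega> < \<infinity>}"
      using n(1) by (auto intro: le_less_trans)
  qed
  also have "\<dots> \<in> sets F0"
    by (rule sets.countable_UN) (use X_in_F0[OF _ None_sets_Eborel] in auto)
  finally show ?thesis .
qed

end

section \<open>Paths do not skip states\<close>

text \<open>Symmetric under reversal of the order, so that upward and downward passage share their
  proofs.\<close>

definition betw :: "ereal \<Rightarrow> ereal \<Rightarrow> ereal \<Rightarrow> bool" where
  "betw a x b \<longleftrightarrow> a < x \<and> x < b \<or> b < x \<and> x < a"

lemma betw_neq: "betw a x b \<Longrightarrow> a \<noteq> x \<and> x \<noteq> b \<and> a \<noteq> b"
  by (auto simp: betw_def)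

context hunt begin

text \<open>\<open>measure\<close> is \<open>0\<close> on non-measurable sets, so without this the
  hitting probability would be meaningless. Off \<open>N y\<close>, which is null for every starting
  state, \<open>hit X y\<close> equals the path-measurable \<open>D y\<close>; universal
  completeness then transfers measurability.\<close>

lemma hit_less_sets:
  assumes "a \<in> E" "b \<in> E"
  shows "{\<omega> \<in> space M. hit X b \<omega> < hit X a \<omega>} \<in> sets M"
proof -
  define R where "R = {q::real. q \<in> \<rat> \<and> 0 < q}"
  have R: "countable R" unfolding R_def by (auto intro: countable_subset[OF _ countable_rat])
  define N where "N y = (\<Union>q\<in>R. bad (Some y) q)" for y
  define D where "D y \<omega> = (INF q\<in>R. approach (Some y) q \<omega>)" for y \<omega>
  have N_sets: "N y \<in> sets F0" if "y \<in> E" for y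
    unfolding N_def using that R by (intro sets.countable_UN'' bad_F0) (auto simp: R_def)
  have N_null: "N y \<in> null_sets (P z)" if "y \<in> E" "z \<in> S" for y z
    unfolding N_def using that R by (intro null_sets_UN' bad_null) (auto simp: R_def)
  have D_meas: "D y \<in> borel_measurable F0" if "y \<in> E" for y
    unfolding D_def using that R by (intro borel_measurable_INF approach_measurable) (auto simp: R_def)
  have D_eq: "hit X y \<omega> = D y \<omega>" if "y \<in> E" "\<omega> \<in> space M" "\<omega> \<notin> N y" for y \<omega>
  proof (rule antisym)
    show "hit X y \<omega> \<le> D y \<omega>"
      unfolding D_def
    proof (rule INF_greatest)
      fix q assume q: "q \<in> R"
      show "hit X y \<omega> \<le> approach (Some y) q \<omega>"
      proof (cases "approach (Some y) q \<omega> < \<infinity>")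
        case True
        then obtain t where t: "approach (Some y) q \<omega> = ennreal t" "t \<ge> 0"
          by (cases "approach (Some y) q \<omega>") auto
        have "\<omega> \<notin> bad (Some y) q" using that(3) q by (auto simp: N_def)
        then have "X t \<omega> = Some y" using that(2) True t by (auto simp: bad_def)
        moreover have "ennreal q \<le> ennreal t" using approach_ge[of q "Some y" \<omega>] t by simp
        ultimately show ?thesis
          using t q unfolding hit_def by (intro INF_lower2[of t]) (auto simp: R_def)
      next
        case False
        then show ?thesis by (metis infinity_ennreal_def top.not_eq_extremum top_greatest)
      qed
    qed
    show "D y \<omega> \<le> hit X y \<omega>"
      unfolding hit_def
    proof (rule INF_greatest)
      fix t assume "t \<in> {t. 0 < t \<and> X t \<omega> = Some y}"
      then have t: "0 < t" "X t \<omega> = Some y" by auto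
      then obtain q where "q \<in> \<rat>" "0 < q" "q < t" using Rats_dense_in_real by blast
      with t that(1) show "D y \<omega> \<le> ennreal t"
        unfolding D_def by (intro INF_lower2[of q] approach_le) (auto simp: R_def)
    qed
  qed
  note [measurable] = D_meas[OF assms(1)] D_meas[OF assms(2)]
  let ?A = "{\<omega> \<in> space M. hit X b \<omega> < hit X a \<omega>}"
  let ?B = "{\<omega> \<in> space F0. D b \<omega> < D a \<omega>}"
  have B: "?B \<in> sets F0" by measurable
  have N: "N a \<union> N b \<in> sets F0" using N_sets assms by blast
  have sub: "(?A - ?B) \<union> (?B - ?A) \<subseteq> N a \<union> N b"
  proof
    fix \<omega> assume \<omega>: "\<omega> \<in> (?A - ?B) \<union> (?B - ?A)"
    show "\<omega> \<in> N a \<union> N b"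
    proof (rule ccontr)
      assume "\<omega> \<notin> N a \<union> N b"
      then have "\<omega> \<notin> N a" "\<omega> \<notin> N b" by auto
      with \<omega> show False using D_eq[OF assms(1), of \<omega>] D_eq[OF assms(2), of \<omega>] by auto
    qed
  qed
  have "Pmix P \<mu> (N a \<union> N b) = 0" if "\<mu> \<in> init_dists E" for \<mu>
  proof -
    have "space \<mu> = S"
      using that sets_eq_imp_space_eq[of \<mu> "Eborel E"] by (auto simp: init_dists_def space_Eborel)
    then have "Pmix P \<mu> (N a \<union> N b) = (\<integral>\<^sup>+ x. 0 \<partial>\<mu>)"
      unfolding Pmix_def using N_null assms by (intro nn_integral_cong) (auto intro!: null_setsD1)
    then show ?thesis by simp
  qed
  then have "\<forall>\<mu>\<in>init_dists E. \<exists>B\<in>natural_sets E M X. \<exists>N\<in>natural_sets E M X.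
     (?A - B) \<union> (B - ?A) \<subseteq> N \<and> Pmix P \<mu> N = 0"
    using B N sub unfolding sets_F0 by blast
  then show ?thesis using complete[rule_format, of ?A] by blast
qed

lemma hit_eq_passage:
  assumes "y \<in> E" "\<omega> \<in> space M" "\<omega> \<notin> bad (Some y) 0" "X 0 \<omega> \<noteq> Some y"
  shows "hit X y \<omega> = passage y \<omega>"
proof (rule antisym)
  show "hit X y \<omega> \<le> passage y \<omega>"
  proof (cases "passage y \<omega> < \<infinity>")
    case True
    then obtain t where t: "passage y \<omega> = ennreal t" "t \<ge> 0"
      by (cases "passage y \<omega>") auto
    then have "X t \<omega> = Some y" using assms True by (auto simp: bad_def passage_def)
    moreover from this have "t \<noteq> 0" using assms(4) by auto
    ultimately show ?thesis
      using t unfolding hit_def by (intro INF_lower2[of t]) auto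
  next
    case False
    then show ?thesis by (metis infinity_ennreal_def top.not_eq_extremum top_greatest)
  qed
  show "passage y \<omega> \<le> hit X y \<omega>"
    unfolding hit_def using assms(1) by (intro INF_greatest passage_le) auto
qed

end

locale skip_free = hunt E M P X \<theta> Ft for E and M :: "'w measure" and P X \<theta> Ft +
  assumes skip_free: "skip_free_Hunt E M P X \<theta> Ft"
begin

text \<open>Collects the almost sure properties of a path, so that the later path arguments are
  deterministic. \<open>Y\<close> lists the states whose passage is considered, since the
  exceptional null set depends on the state.\<close>

definition regular :: "ereal \<Rightarrow> ereal set \<Rightarrow> 'w \<Rightarrow> bool" where
  "regular x Y \<omega> \<longleftrightarrow> \<omega> \<in> space M \<and> X 0 \<omega> = Some x \<and>
    (\<forall>t. 0 < t \<and> ennreal t < lifetime X \<omega> \<longrightarrow>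
        (\<forall>z. limitin (Etop E) (\<lambda>s. X s \<omega>) z (at_left t) \<longrightarrow>
           {min (sval E z) (sval E (X t \<omega>)) <..< max (sval E z) (sval E (X t \<omega>))} \<inter> E = {})) \<and>
    (lifetime X \<omega> < \<infinity> \<longrightarrow>
          (\<forall>z. limitin (Etop E) (\<lambda>s. X s \<omega>) z (at_left (enn2real (lifetime X \<omega>)))
                \<longrightarrow> z \<notin> Some ` E)) \<and>
    \<omega> \<notin> bad None 0 \<and> (\<forall>y\<in>Y. \<omega> \<notin> bad (Some y) 0)"

lemma regularD:
  assumes "regular x Y \<omega>"
  shows "\<omega> \<in> space M" "X 0 \<omega> = Some x"
    "\<And>t z. 0 < t \<Longrightarrow> ennreal t < lifetime X \<omega> \<Longrightarrow> limitin (Etop E) (\<lambda>s. X s \<omega>) z (at_left t) \<Longrightarrow>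
           {min (sval E z) (sval E (X t \<omega>)) <..< max (sval E z) (sval E (X t \<omega>))} \<inter> E = {}"
    "\<And>z. lifetime X \<omega> < \<infinity> \<Longrightarrow>
        limitin (Etop E) (\<lambda>s. X s \<omega>) z (at_left (enn2real (lifetime X \<omega>))) \<Longrightarrow> z \<notin> Some ` E"
    "\<omega> \<notin> bad None 0" "\<And>y. y \<in> Y \<Longrightarrow> \<omega> \<notin> bad (Some y) 0"
  using assms unfolding regular_def by blast+

lemma AE_regular:
  assumes "x \<in> E" "countable Y" "Y \<subseteq> E"
  shows "AE \<omega> in P (Some x). regular x Y \<omega>"
proof -
  have x: "Some x \<in> S" using assms by simp
  have "AE \<omega> in P (Some x). \<omega> \<in> space M" using space_P[OF x] AE_space by metis
  moreover have "AE \<omega> in P (Some x). X 0 \<omega> = Some x" using normal x by blast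
  moreover have "AE \<omega> in P (Some x). \<forall>t. 0 < t \<and> ennreal t < lifetime X \<omega> \<longrightarrow>
        (\<forall>z. limitin (Etop E) (\<lambda>s. X s \<omega>) z (at_left t) \<longrightarrow>
           {min (sval E z) (sval E (X t \<omega>)) <..< max (sval E z) (sval E (X t \<omega>))} \<inter> E = {})"
    using skip_free assms(1) unfolding skip_free_Hunt_def by (elim conjE) (erule bspec)
  moreover have "AE \<omega> in P (Some x). lifetime X \<omega> < \<infinity> \<longrightarrow>
          (\<forall>z. limitin (Etop E) (\<lambda>s. X s \<omega>) z (at_left (enn2real (lifetime X \<omega>)))
                \<longrightarrow> z \<notin> Some ` E)"
  \<comment> \<open>(SK) describes the left limit at the lifetime only when killing has positive
    probability; if it has none from \<open>x\<close>, the lifetime is almost surely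
    infinite.\<close>
  proof (cases "measure (P (Some x)) {\<omega> \<in> space M. lifetime X \<omega> < \<infinity>} > 0")
    case True
    then show ?thesis using skip_free assms(1) unfolding skip_free_Hunt_def by (elim conjE) blast
  next
    case False
    interpret prob_space "P (Some x)" using prob_space_P x .
    have "{\<omega> \<in> space M. lifetime X \<omega> < \<infinity>} \<in> sets (P (Some x))"
      using lifetime_finite_F0 F0_sets_M sets_P[OF x] by blast
    moreover have "prob {\<omega> \<in> space M. lifetime X \<omega> < \<infinity>} = 0"
      using False by (simp add: zero_less_measure_iff)
    ultimately have "{\<omega> \<in> space M. lifetime X \<omega> < \<infinity>} \<in> null_sets (P (Some x))"
      by (simp add: null_sets_def emeasure_eq_measure)
    from AE_not_in[OF this] AE_space[of "P (Some x)"] show ?thesis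
      unfolding space_P[OF x] by (auto elim!: AE_mp)
  qed
  moreover have "AE \<omega> in P (Some x). \<omega> \<notin> bad None 0" using x by (intro AE_not_bad) auto
  moreover have "AE \<omega> in P (Some x). \<forall>y\<in>Y. \<omega> \<notin> bad (Some y) 0"
    using x assms by (subst AE_ball_countable) (auto intro!: AE_not_bad)
  ultimately show ?thesis unfolding regular_def by (intro AE_conjI) assumption+
qed

lemma passage_attained:
  assumes "\<omega> \<in> space M" "\<omega> \<notin> bad (Some y) 0" "passage y \<omega> < \<infinity>"
  obtains t where "t \<ge> 0" "passage y \<omega> = ennreal t" "X t \<omega> = Some y"
proof -
  obtain t where "passage y \<omega> = ennreal t" "t \<ge> 0"
    using assms(3) by (cases "passage y \<omega>") auto
  with assms show thesis by (intro that[of t]) (auto simp: bad_def passage_def)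
qed

lemma passage_neq:
  assumes "regular x Y \<omega>" "y \<in> Y" "z \<in> Y" "y \<noteq> z" "passage y \<omega> < \<infinity>"
  shows "passage y \<omega> \<noteq> passage z \<omega>"
proof
  assume eq: "passage y \<omega> = passage z \<omega>"
  obtain t where t: "t \<ge> 0" "passage y \<omega> = ennreal t" "X t \<omega> = Some y"
    using passage_attained assms regularD by metis
  obtain s where s: "s \<ge> 0" "passage z \<omega> = ennreal s" "X s \<omega> = Some z"
    using passage_attained[of \<omega> z] assms regularD eq by metis
  show False using s t eq assms(4) by auto
qed

text \<open>A path that skips over \<open>y\<close> does so at the first time it is beyond \<open>y\<close>.  Its left limit
  there is neither \<open>y\<close> nor the cemetery, because the path would have been at that limit by
  quasi-left-continuity.\<close>

lemma no_skip:
  assumes reg: "regular x Y \<omega>" and y: "y \<in> Y" "Y \<subseteq> E"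
    and sides: "O1 = {..<y} \<and> O2 = {y<..} \<or> O1 = {y<..} \<and> O2 = {..<y}" and x: "x \<in> O1"
    and t: "t \<ge> 0" "X t \<omega> \<noteq> None" "ennreal t < passage y \<omega>"
  shows "\<exists>w\<in>E \<inter> O1. X t \<omega> = Some w"
proof (rule ccontr)
  assume neg: "\<not> (\<exists>w\<in>E \<inter> O1. X t \<omega> = Some w)"
  have \<omega>: "\<omega> \<in> space M" using regularD(1)[OF reg] .
  have yE: "y \<in> E" using y by blast
  have op: "open O1" "open O2" using sides by auto
  have dis: "O1 \<inter> O2 = {}" and cov: "\<And>w. w = y \<or> w \<in> O1 \<or> w \<in> O2" using sides by auto
  have alive: "X s \<omega> \<noteq> None" if "0 \<le> s" "s \<le> t" for s
    using absorbing[OF \<omega> that] t(2) by blast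
  have pos: "X s \<omega> \<in> Some ` (E \<inter> O1) \<or> X s \<omega> \<in> Some ` (E \<inter> O2)" if s: "0 \<le> s" "s \<le> t" for s
  proof -
    have "X s \<omega> \<noteq> Some y"
    proof
      assume "X s \<omega> = Some y"
      then have "passage y \<omega> \<le> ennreal s" using passage_le[OF yE s(1)] by blast
      also have "\<dots> \<le> ennreal t" using s by (simp add: ennreal_leI)
      finally show False using t(3) by simp
    qed
    moreover obtain w where "X s \<omega> = Some w" "w \<in> E"
      using alive[OF s] path_in[OF \<omega> s(1)] by (auto simp: topspace_Etop)
    ultimately show ?thesis using cov[of w] by auto
  qed
  define B where "B = {s. 0 \<le> s \<and> s \<le> t \<and> X s \<omega> \<in> Some ` (E \<inter> O2)}"
  have tB: "t \<in> B" using pos[of t] neg t(1) by (auto simp: B_def)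
  have bdd: "bdd_below B" unfolding B_def by (auto intro: bdd_belowI[of _ 0])
  define u where "u = Inf B"
  have u: "0 \<le> u" "u \<le> t"
    using tB bdd unfolding u_def by (auto intro!: cInf_greatest cInf_lower simp: B_def)
  have before: "X s \<omega> \<in> Some ` (E \<inter> O1)" if "0 \<le> s" "s < u" for s
  proof -
    have "s \<notin> B" using that cInf_lower[OF _ bdd] unfolding u_def by force
    then show ?thesis using pos[of s] that u by (auto simp: B_def)
  qed
  have at: "X u \<omega> \<in> Some ` (E \<inter> O2)"
  proof (rule ccontr)
    assume not: "X u \<omega> \<notin> Some ` (E \<inter> O2)"
    then have "X u \<omega> \<in> Some ` (E \<inter> O1)" using pos u by blast
    then obtain d where d: "d > 0" "\<And>s. u \<le> s \<Longrightarrow> s < u + d \<Longrightarrow> X s \<omega> \<in> Some ` (E \<inter> O1)"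
      using right_cont[OF \<omega> u(1) openin_Etop_Some[OF op(1)]] by blast
    obtain s where s: "s \<in> B" "s < u + d"
      using cInf_lessD[of B "u + d"] tB d(1) unfolding u_def by force
    have "u \<le> s" using cInf_lower[OF s(1) bdd] unfolding u_def .
    then have "X s \<omega> \<in> Some ` (E \<inter> O1)" using d s by blast
    then show False using s dis by (auto simp: B_def)
  qed
  have "u \<noteq> 0" using at regularD(2)[OF reg] x dis by auto
  then have u0: "u > 0" using u by simp
  obtain z where z: "limitin (Etop E) (\<lambda>s. X s \<omega>) z (at_left u)"
    using left_limit[OF \<omega> u0] by blast
  have "z \<in> S" using z by (simp add: limitin_def)
  have "z \<noteq> None"
  proof
    assume "z = None"
    then have le: "approach None 0 \<omega> \<le> ennreal u" using approach_le_left[OF None_in_S u0] z by blast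
    then have "approach None 0 \<omega> < \<infinity>" by (auto intro: le_less_trans)
    then have "X (enn2real (approach None 0 \<omega>)) \<omega> = None"
      using regularD(5)[OF reg] \<omega> by (auto simp: bad_def)
    moreover have "enn2real (approach None 0 \<omega>) \<le> u" using le u0 by (simp add: enn2real_leI)
    ultimately have "X u \<omega> = None" using absorbing[OF \<omega> enn2real_nonneg] by blast
    then show False using at by auto
  qed
  then obtain w where w: "z = Some w" "w \<in> E" using \<open>z \<in> S\<close> by (auto simp: topspace_Etop)
  have "w \<noteq> y"
  proof
    assume "w = y"
    then have "passage y \<omega> \<le> ennreal u"
      unfolding passage_def using w z yE u0 by (intro approach_le_left) auto
    also have "\<dots> \<le> ennreal t" using u by (simp add: ennreal_leI)
    finally show False using t(3) by simp
  qed
  moreover have "w \<notin> O2"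
  proof
    assume "w \<in> O2"
    then obtain d where d: "d > 0" "\<And>s. u - d < s \<Longrightarrow> s < u \<Longrightarrow> X s \<omega> \<in> Some ` (E \<inter> O2)"
      using limitin_at_leftD[OF z openin_Etop_Some[OF op(2)]] w by blast
    have "max 0 (u - d) < u" using d u0 by simp
    then obtain s where s: "max 0 (u - d) < s" "s < u" using dense by blast
    then have "X s \<omega> \<in> Some ` (E \<inter> O2)" "X s \<omega> \<in> Some ` (E \<inter> O1)" using d before by auto
    then show False using dis by auto
  qed
  ultimately have w1: "w \<in> O1" using cov by blast
  obtain v where v: "X u \<omega> = Some v" "v \<in> O2" using at by auto
  have "ennreal u < lifetime X \<omega>" using less_lifetime[OF \<omega> u(1)] v by simp
  then have "{min w v <..< max w v} \<inter> E = {}"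
    using regularD(3)[OF reg u0 _ z] v w by (simp add: sval_def)
  moreover have "y \<in> {min w v <..< max w v}" using w1 v sides by auto
  ultimately show False using yE by blast
qed

text \<open>Until \<open>a\<close> or \<open>b\<close> is reached, \<open>no_skip\<close> on both
  sides confines a living path to the interval. If it were killed there, its left limit at the
  lifetime would be the cemetery by (SK); but the states outside \<open>{a..b}\<close> together with
  the cemetery form a neighbourhood of the cemetery, which such a path never enters before.\<close>

lemma no_killing:
  assumes reg: "regular x Y \<omega>" and Y: "a \<in> Y" "b \<in> Y" "Y \<subseteq> E" and "a < x" "x < b"
    and t: "t \<ge> 0" "ennreal t < passage a \<omega>" "ennreal t < passage b \<omega>"
  shows "\<exists>w\<in>E. a < w \<and> w < b \<and> X t \<omega> = Some w"
proof -
  have \<omega>: "\<omega> \<in> space M" using regularD(1)[OF reg] .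
  have alive: "\<exists>w\<in>E. a < w \<and> w < b \<and> X s \<omega> = Some w" if s: "0 \<le> s" "s \<le> t" "X s \<omega> \<noteq> None" for s
  proof -
    have le: "ennreal s \<le> ennreal t" using s by (simp add: ennreal_leI)
    have "ennreal s < passage a \<omega>" "ennreal s < passage b \<omega>"
      using le_less_trans[OF le t(2)] le_less_trans[OF le t(3)] .
    then show ?thesis
      using no_skip[OF reg Y(1,3), of "{a<..}" "{..<a}" s] no_skip[OF reg Y(2,3), of "{..<b}" "{b<..}" s]
        s assms(5,6) by auto
  qed
  show ?thesis
  proof (cases "X t \<omega> = None")
    case False
    then show ?thesis using alive[of t] t by simp
  next
    case True
    have fin: "lifetime X \<omega> \<le> ennreal t" using lifetime_le[of t X \<omega>] True t by blast
    then obtain u where u: "lifetime X \<omega> = ennreal u" "u \<ge> 0"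
      by (cases "lifetime X \<omega>") (auto simp: top_unique)
    have ut: "u \<le> t" using fin u t by simp
    have before: "\<exists>w\<in>E. a < w \<and> w < b \<and> X s \<omega> = Some w" if s: "0 \<le> s" "s < u" for s
    proof (rule alive)
      show "X s \<omega> \<noteq> None"
      proof
        assume "X s \<omega> = None"
        then have "ennreal u \<le> ennreal s" using lifetime_le[of s X \<omega>] s u by simp
        then show False using s by simp
      qed
    qed (use s ut in auto)
    have "ennreal 0 < lifetime X \<omega>" using less_lifetime[OF \<omega>, of 0] regularD(2)[OF reg] by simp
    then have u0: "u > 0" using u by simp
    obtain z where z: "limitin (Etop E) (\<lambda>s. X s \<omega>) z (at_left u)"
      using left_limit[OF \<omega> u0] by blast
    then have "z \<in> S" by (simp add: limitin_def)
    moreover have "z \<notin> Some ` E" using regularD(4)[OF reg] u z by simp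
    ultimately have zN: "z = None" by (auto simp: topspace_Etop)
    have "Inf E \<le> a" "b \<le> Sup E" using Y by (auto intro: Inf_lower Sup_upper)
    \<comment> \<open>A missing endpoint differs from \<open>a\<close> and \<open>b\<close>, which
      lie in \<open>E\<close>, hence is strictly outside the closed interval.\<close>
    then have "{Inf E, Sup E} - E \<subseteq> - {a..b}"
      using Y assms(5,6) by auto
    then have op: "openin (Etop E) (insert None (Some ` (E \<inter> (- {a..b}))))"
      by (intro openin_Etop_None) auto
    obtain d where d: "d > 0"
       "\<And>s. u - d < s \<Longrightarrow> s < u \<Longrightarrow> X s \<omega> \<in> insert None (Some ` (E \<inter> (- {a..b})))"
      using limitin_at_leftD[OF z op] zN by blast
    have "max 0 (u - d) < u" using d u0 by simp
    then obtain s where s: "max 0 (u - d) < s" "s < u" using dense by blast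
    then show ?thesis using d(2)[of s] before[of s] by auto
  qed
qed

text \<open>Otherwise the path would be at \<open>z\<close>, beyond \<open>y\<close>, before
  reaching \<open>y\<close>; a tie would put it at two states at once.\<close>

lemma passage_order:
  assumes reg: "regular x Y \<omega>" and Y: "y \<in> Y" "z \<in> Y" "Y \<subseteq> E" and betw: "betw x y z"
    and fin: "passage z \<omega> < \<infinity>"
  shows "passage y \<omega> < passage z \<omega>"
proof (rule ccontr)
  assume "\<not> passage y \<omega> < passage z \<omega>"
  moreover have "passage z \<omega> \<noteq> passage y \<omega>"
    using passage_neq[OF reg Y(2,1) _ fin] betw_neq[OF betw] by blast
  ultimately have less: "passage z \<omega> < passage y \<omega>" by simp
  obtain t where t: "t \<ge> 0" "passage z \<omega> = ennreal t" "X t \<omega> = Some z"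
    using passage_attained regularD(1,6)[OF reg] Y(2) fin by metis
  show False
    using no_skip[OF reg Y(1,3), of "{..<y}" "{y<..}" t] no_skip[OF reg Y(1,3), of "{y<..}" "{..<y}" t]
      t less betw by (auto simp: betw_def)
qed

end

section \<open>Passage probabilities\<close>

context skip_free begin

lemma F0_sets_P: "z \<in> S \<Longrightarrow> A \<in> sets F0 \<Longrightarrow> A \<in> sets (P z)"
  using F0_sets_M sets_P by blast

lemma passage_less_F0: "y \<in> E \<Longrightarrow> z \<in> E \<Longrightarrow> {\<omega> \<in> space M. passage y \<omega> < passage z \<omega>} \<in> sets F0"
proof -
  assume "y \<in> E" "z \<in> E"
  note [measurable] = this[THEN passage_measurable]
  have "{\<omega> \<in> space F0. passage y \<omega> < passage z \<omega>} \<in> sets F0" by measurable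
  then show ?thesis unfolding space_F0 .
qed

lemma passage_le_F0: "y \<in> E \<Longrightarrow> {\<omega> \<in> space M. passage y \<omega> \<le> t} \<in> sets F0"
proof -
  assume "y \<in> E"
  note [measurable] = this[THEN passage_measurable]
  have "{\<omega> \<in> space F0. passage y \<omega> \<le> t} \<in> sets F0" by measurable
  then show ?thesis unfolding space_F0 .
qed

lemma passage_less_const_F0: "y \<in> E \<Longrightarrow> {\<omega> \<in> space M. passage y \<omega> < t} \<in> sets F0"
proof -
  assume "y \<in> E"
  note [measurable] = this[THEN passage_measurable]
  have "{\<omega> \<in> space F0. passage y \<omega> < t} \<in> sets F0" by measurable
  then show ?thesis unfolding space_F0 .
qed

definition pass_before :: "ereal \<Rightarrow> ereal \<Rightarrow> ereal \<Rightarrow> real" where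
  "pass_before x y a = measure (P (Some x)) {\<omega> \<in> space M. passage y \<omega> < passage a \<omega>}"

definition reach :: "ereal \<Rightarrow> ereal \<Rightarrow> real \<Rightarrow> real" where
  "reach x y t = measure (P (Some x)) {\<omega> \<in> space M. passage y \<omega> \<le> ennreal t}"

lemma prob_P: "x \<in> E \<Longrightarrow> prob_space (P (Some x))"
  using prob_space_P by simp

text \<open>For upper bounds an almost sure inclusion is enough, which avoids describing the shifted
  event exactly.\<close>

lemma strong_Markov_le:
  assumes "x \<in> E" "y \<in> E" "A \<in> stopped_sets M Ft (passage y)" "B \<in> sets F0"
    and AE: "AE \<omega> in P (Some x). \<omega> \<in> C \<longrightarrow>
      \<omega> \<in> A \<and> passage y \<omega> < \<infinity> \<and> \<theta> (enn2real (passage y \<omega>)) \<omega> \<in> B"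
  shows "measure (P (Some x)) C \<le> measure (P (Some x)) {\<omega> \<in> A. passage y \<omega> < \<infinity>} * measure (P (Some y)) B"
proof -
  interpret prob_space "P (Some x)" using prob_P assms(1) .
  have x: "Some x \<in> S" using assms(1) by simp
  have "measure (P (Some x)) C \<le>
      measure (P (Some x)) {\<omega> \<in> A. passage y \<omega> < \<infinity> \<and> \<theta> (enn2real (passage y \<omega>)) \<omega> \<in> B}"
    using AE strong_Markov_passage(1)[OF x assms(2-4)] sets_P[OF x]
    by (intro finite_measure_mono_AE) auto
  then show ?thesis using strong_Markov_passage(2)[OF x assms(2-4)] by simp
qed

text \<open>The bound is uniform in \<open>z\<close>: it makes the exit time of \<open>(a, b)\<close> finite.\<close>

lemma reach_mono:
  assumes "a \<in> E" "z \<in> E" "b \<in> E" "betw a z b"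
  shows "reach a b t \<le> reach z b t"
proof -
  interpret prob_space "P (Some a)" using prob_P assms(1) .
  let ?A = "{\<omega> \<in> space M. passage b \<omega> \<le> ennreal t}"
  \<comment> \<open>On its way from \<open>a\<close> to \<open>b\<close> the path meets
    \<open>z\<close>, and from there at most the time \<open>t\<close> remains.\<close>
  have "reach a b t \<le> measure (P (Some a)) {\<omega> \<in> space M. passage z \<omega> < \<infinity>} * reach z b t"
    unfolding reach_def
  proof (rule strong_Markov_le[OF assms(1,2) stopped_space[OF passage_stopping[OF assms(2)]] passage_le_F0[OF assms(3)]])
    show "AE \<omega> in P (Some a). \<omega> \<in> ?A \<longrightarrow>
      \<omega> \<in> space M \<and> passage z \<omega> < \<infinity> \<and> \<theta> (enn2real (passage z \<omega>)) \<omega> \<in> ?A"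
    proof (rule AE_mp[OF AE_regular[OF assms(1), of "{z, b}"]])
      show "AE \<omega> in P (Some a). regular a {z, b} \<omega> \<longrightarrow> \<omega> \<in> ?A \<longrightarrow>
        \<omega> \<in> space M \<and> passage z \<omega> < \<infinity> \<and> \<theta> (enn2real (passage z \<omega>)) \<omega> \<in> ?A"
      proof (intro AE_I2 impI)
        fix \<omega> assume reg: "regular a {z, b} \<omega>" and A: "\<omega> \<in> ?A"
        then have \<omega>: "\<omega> \<in> space M" "passage b \<omega> \<le> ennreal t" by auto
        then have "passage b \<omega> < \<infinity>" by (auto intro: le_less_trans)
        then have less: "passage z \<omega> < passage b \<omega>"
          using passage_order[OF reg, of z b] assms by auto
        then obtain r where r: "passage z \<omega> = ennreal r" "r \<ge> 0"
          by (cases "passage z \<omega>") auto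
        have "passage b \<omega> = ennreal r + passage b (\<theta> r \<omega>)"
          using passage_shift[OF \<omega>(1) assms(3) r(2)] less r by simp
        then have "passage b (\<theta> r \<omega>) \<le> passage b \<omega>" by simp
        then have "passage b (\<theta> r \<omega>) \<le> ennreal t" using \<omega>(2) by (rule order_trans)
        then show "\<omega> \<in> space M \<and> passage z \<omega> < \<infinity> \<and> \<theta> (enn2real (passage z \<omega>)) \<omega> \<in> ?A"
          using r \<omega> shift_space by simp
      qed
    qed (use assms in auto)
  qed
  also have "\<dots> \<le> 1 * reach z b t"
    by (intro mult_right_mono prob_le_1) (simp add: reach_def)
  finally show ?thesis by simp
qed

lemma AE_hit_eq:
  assumes "x \<in> E" "y \<in> E" "x \<noteq> y"
  shows "AE \<omega> in P (Some x). hit X y \<omega> = passage y \<omega>"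
proof (rule AE_mp[OF AE_regular[OF assms(1), of "{y}"]])
  show "AE \<omega> in P (Some x). regular x {y} \<omega> \<longrightarrow> hit X y \<omega> = passage y \<omega>"
  proof (intro AE_I2 impI)
    fix \<omega> assume reg: "regular x {y} \<omega>"
    show "hit X y \<omega> = passage y \<omega>"
      using regularD(1,2,6)[OF reg] assms by (intro hit_eq_passage) auto
  qed
qed (use assms in auto)

section \<open>Positivity of passage probabilities\<close>

lemma passage_finite_pos:
  assumes "x \<in> E" "y \<in> E" "x \<noteq> y"
  shows "measure (P (Some x)) {\<omega> \<in> space M. passage y \<omega> < \<infinity>} > 0"
proof -
  interpret prob_space "P (Some x)" using prob_P assms(1) .
  have x: "Some x \<in> S" using assms(1) by simp
  have "\<forall>x\<in>E. \<forall>y\<in>E. measure (P (Some x)) {\<omega> \<in> space M. hit X y \<omega> < \<infinity>} > 0"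
    using skip_free unfolding skip_free_Hunt_def by (elim conjE)
  then have "0 < measure (P (Some x)) {\<omega> \<in> space M. hit X y \<omega> < \<infinity>}" using assms by blast
  also have "\<dots> \<le> measure (P (Some x)) {\<omega> \<in> space M. passage y \<omega> < \<infinity>}"
  proof (rule finite_measure_mono_AE)
    show "AE \<omega> in P (Some x). \<omega> \<in> {\<omega> \<in> space M. hit X y \<omega> < \<infinity>} \<longrightarrow> \<omega> \<in> {\<omega> \<in> space M. passage y \<omega> < \<infinity>}"
      using AE_hit_eq[OF assms] by (rule AE_mp) (auto intro!: AE_I2)
    show "{\<omega> \<in> space M. passage y \<omega> < \<infinity>} \<in> sets (P (Some x))"
      using passage_less_const_F0[OF assms(2)] F0_sets_P x by blast
  qed
  finally show ?thesis .
qed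

text \<open>Continuity of the measure along increasing times. The multiples of \<epsilon> match the
  induction in \<open>pass_before_pos\<close>, which shows that all these probabilities would
  vanish.\<close>

lemma reach_pos:
  assumes "x \<in> E" "y \<in> E" "x \<noteq> y" "\<epsilon> > 0"
  shows "\<exists>n. reach x y (real n * \<epsilon>) > 0"
proof (rule ccontr)
  assume neg: "\<not> (\<exists>n. reach x y (real n * \<epsilon>) > 0)"
  interpret prob_space "P (Some x)" using prob_P assms(1) .
  have x: "Some x \<in> S" using assms(1) by simp
  let ?A = "\<lambda>n. {\<omega> \<in> space M. passage y \<omega> \<le> ennreal (real n * \<epsilon>)}"
  have sets: "?A n \<in> sets (P (Some x))" for n
    using passage_le_F0[OF assms(2)] F0_sets_P x by blast
  have "measure (P (Some x)) (?A n) = 0" for n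
    using neg unfolding reach_def by (simp add: zero_less_measure_iff)
  then have "?A n \<in> null_sets (P (Some x))" for n
    using sets by (auto simp: null_sets_def emeasure_eq_measure)
  then have "(\<Union>n. ?A n) \<in> null_sets (P (Some x))" by (rule null_sets_UN)
  moreover have "(\<Union>n. ?A n) = {\<omega> \<in> space M. passage y \<omega> < \<infinity>}"
  proof (intro set_eqI iffI)
    fix \<omega> assume "\<omega> \<in> {\<omega> \<in> space M. passage y \<omega> < \<infinity>}"
    then have \<omega>: "\<omega> \<in> space M" "passage y \<omega> < \<infinity>" by auto
    then obtain t where t: "passage y \<omega> = ennreal t" "t \<ge> 0" by (cases "passage y \<omega>") auto
    obtain n where "t / \<epsilon> \<le> real n" using real_arch_simple by blast
    then have "t \<le> real n * \<epsilon>" using assms(4) by (simp add: field_simps)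
    then show "\<omega> \<in> (\<Union>n. ?A n)" using t \<omega> by (auto intro!: ennreal_leI)
  qed (auto intro: le_less_trans)
  ultimately show False
    using passage_finite_pos[OF assms(1-3)] by (simp add: measure_eq_0_null_sets)
qed

lemma AE_passage_pos:
  assumes "x \<in> E" "y \<in> E" "x \<noteq> y"
  shows "AE \<omega> in P (Some x). 0 < passage y \<omega>"
proof (rule AE_mp[OF AE_regular[OF assms(1), of "{y}"]])
  show "AE \<omega> in P (Some x). regular x {y} \<omega> \<longrightarrow> 0 < passage y \<omega>"
  proof (intro AE_I2 impI)
    fix \<omega> assume reg: "regular x {y} \<omega>"
    show "0 < passage y \<omega>"
    proof (rule ccontr)
      assume "\<not> 0 < passage y \<omega>"
      then have "passage y \<omega> = 0" by simp
      then have "X 0 \<omega> = Some y"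
        using regularD(1,6)[OF reg] by (auto simp: bad_def passage_def)
      then show False using regularD(2)[OF reg] assms(3) by simp
    qed
  qed
qed (use assms in auto)

text \<open>If \<open>b\<close> were never reached before \<open>a\<close>, then with \<open>p = P\<^sub>x(T\<^sub>a < \<epsilon>)\<close> the strong Markov property
  at \<open>T\<^sub>a\<close> gives \<open>P\<^sub>x(T\<^sub>b \<le> t) \<le> p P\<^sub>x(T\<^sub>b \<le> t) + P\<^sub>x(T\<^sub>b \<le> t - \<epsilon>)\<close>.
  Hence \<open>P\<^sub>x(T\<^sub>b \<le> n \<epsilon>) = 0\<close> for all \<open>n\<close> once \<open>p < 1\<close>.\<close>

lemma pass_before_pos:
  assumes E: "a \<in> E" "x \<in> E" "b \<in> E" and betw: "betw a x b"
  shows "pass_before x b a > 0"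
proof (rule ccontr)
  assume "\<not> pass_before x b a > 0"
  then have H0: "measure (P (Some x)) {\<omega> \<in> space M. passage b \<omega> < passage a \<omega>} = 0"
    unfolding pass_before_def by (simp add: zero_less_measure_iff)
  interpret prob_space "P (Some x)" using prob_P E(2) .
  have x: "Some x \<in> S" using E by simp
  have ne: "a \<noteq> x" "x \<noteq> b" "a \<noteq> b" using betw_neq[OF betw] by auto
  have "{\<omega> \<in> space M. passage b \<omega> < passage a \<omega>} \<in> null_sets (P (Some x))"
    using H0 F0_sets_P[OF x passage_less_F0[OF E(3,1)]] by (auto simp: null_sets_def emeasure_eq_measure)
  then have AE0: "AE \<omega> in P (Some x). \<omega> \<notin> {\<omega> \<in> space M. passage b \<omega> < passage a \<omega>}"
    by (rule AE_not_in)
  have AEr: "AE \<omega> in P (Some x). regular x {a, b} \<omega>"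
    using AE_regular[OF E(2)] E by simp
  have AE1: "AE \<omega> in P (Some x). \<omega> \<in> space M \<and> (passage b \<omega> < \<infinity> \<longrightarrow> passage a \<omega> < passage b \<omega>)"
    using AE0 AEr
  proof (eventually_elim)
    case (elim \<omega>)
    have "\<omega> \<in> space M" using elim(2) E regularD(1) by blast
    moreover have "passage b \<omega> \<noteq> passage a \<omega>" if "passage b \<omega> < \<infinity>"
      using passage_neq[of x "{a, b}" \<omega> b a] elim(2) E ne that by auto
    ultimately show ?case using elim(1) by auto
  qed
  \<comment> \<open>Finds the \<epsilon> for which p is below 1: since \<open>passage a\<close> is
    positive almost surely, these events decrease to a null set.\<close>
  let ?C = "\<lambda>n. {\<omega> \<in> space M. passage a \<omega> < ennreal (1 / real (Suc n))}"
  have C: "?C n \<in> sets (P (Some x))" for n using F0_sets_P[OF x passage_less_const_F0[OF E(1)]] .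
  have "(\<lambda>n. prob (?C n)) \<longlonglongrightarrow> prob (\<Inter>n. ?C n)"
  proof (rule finite_Lim_measure_decseq)
    show "range ?C \<subseteq> sets (P (Some x))" using C by blast
    show "decseq ?C"
    proof (rule decseq_SucI)
      fix n
      have "ennreal (1 / real (Suc (Suc n))) \<le> ennreal (1 / real (Suc n))"
        by (intro ennreal_leI) (simp add: frac_le)
      then show "?C (Suc n) \<subseteq> ?C n" by (auto intro: less_le_trans)
    qed
  qed
  also have "prob (\<Inter>n. ?C n) = 0"
  proof -
    have "(\<Inter>n. ?C n) \<in> null_sets (P (Some x))"
    proof -
      have "AE \<omega> in P (Some x). \<omega> \<notin> (\<Inter>n. ?C n)"
        using AE_passage_pos[OF E(2,1) ne(1)[symmetric]]
      proof eventually_elim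
        case (elim \<omega>)
        show ?case
        proof
          assume "\<omega> \<in> (\<Inter>n. ?C n)"
          then have *: "passage a \<omega> < ennreal (1 / real (Suc n))" for n by auto
          then obtain t where t: "passage a \<omega> = ennreal t" "t \<ge> 0"
            using *[of 0] by (cases "passage a \<omega>") auto
          then have "t > 0" using elim by simp
          then obtain n where "inverse (real (Suc n)) < t" using reals_Archimedean by blast
          then show False using *[of n] t by (simp add: inverse_eq_divide ennreal_less_iff)
        qed
      qed
      then show ?thesis using C by (subst AE_iff_null_sets) auto
    qed
    then show ?thesis by (simp add: measure_eq_0_null_sets)
  qed
  finally have "\<forall>\<^sub>F n in sequentially. prob (?C n) < 1"
    by (rule order_tendstoD) simp
  then obtain n where n: "prob (?C n) < 1" by (auto simp: eventually_sequentially)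
  define \<epsilon> where "\<epsilon> = 1 / real (Suc n)"
  have \<epsilon>: "\<epsilon> > 0" by (simp add: \<epsilon>_def)
  define p where "p = prob {\<omega> \<in> space M. passage a \<omega> < ennreal \<epsilon>}"
  have p: "p < 1" using n by (simp add: p_def \<epsilon>_def)
  have step: "reach x b t \<le> p * reach x b t + reach x b (t - \<epsilon>)" for t
  proof -
    let ?A = "{\<omega> \<in> space M. passage a \<omega> < ennreal \<epsilon>}"
    let ?B = "\<lambda>t. {\<omega> \<in> space M. passage b \<omega> \<le> ennreal t}"
    have A: "?A \<in> stopped_sets M Ft (passage a)"
      using stopped_passage_less[OF E(1) stopping_const] .
    have A': "space M - ?A \<in> stopped_sets M Ft (passage a)"
      using stopped_Compl[OF passage_stopping[OF E(1)] A] .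
    have AM: "?A \<in> sets (P (Some x))" using F0_sets_P[OF x passage_less_const_F0[OF E(1)]] .
    have BM: "?B t \<in> sets (P (Some x))" for t using F0_sets_P[OF x passage_le_F0[OF E(3)]] .
    have shift: "AE \<omega> in P (Some x). \<omega> \<in> ?B t \<longrightarrow> (\<exists>r\<ge>0. \<omega> \<in> space M \<and> passage a \<omega> = ennreal r \<and>
        passage b \<omega> = ennreal r + passage b (\<theta> r \<omega>) \<and> \<theta> r \<omega> \<in> space M)"
      using AE1
    proof eventually_elim
      case (elim \<omega>)
      show ?case
      proof
        assume "\<omega> \<in> ?B t"
        then have "passage b \<omega> < \<infinity>" by (auto intro: le_less_trans)
        then have less: "passage a \<omega> < passage b \<omega>" using elim by blast
        then obtain r where r: "passage a \<omega> = ennreal r" "r \<ge> 0" by (cases "passage a \<omega>") auto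
        then show "\<exists>r\<ge>0. \<omega> \<in> space M \<and> passage a \<omega> = ennreal r \<and>
            passage b \<omega> = ennreal r + passage b (\<theta> r \<omega>) \<and> \<theta> r \<omega> \<in> space M"
          using passage_shift[OF _ E(3) r(2)] shift_space elim less by (intro exI[of _ r]) auto
      qed
    qed
    have 1: "prob (?B t \<inter> ?A) \<le> prob {\<omega> \<in> ?A. passage a \<omega> < \<infinity>} * measure (P (Some a)) (?B t)"
    proof (rule strong_Markov_le[OF E(2,1) A passage_le_F0[OF E(3)]])
      show "AE \<omega> in P (Some x). \<omega> \<in> ?B t \<inter> ?A \<longrightarrow>
          \<omega> \<in> ?A \<and> passage a \<omega> < \<infinity> \<and> \<theta> (enn2real (passage a \<omega>)) \<omega> \<in> ?B t"
        using shift
      proof eventually_elim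
        case (elim \<omega>)
        show ?case
        proof
          assume *: "\<omega> \<in> ?B t \<inter> ?A"
          with elim obtain r where r: "r \<ge> 0" "passage a \<omega> = ennreal r"
            "passage b \<omega> = ennreal r + passage b (\<theta> r \<omega>)" "\<theta> r \<omega> \<in> space M" by blast
          have "passage b (\<theta> r \<omega>) \<le> passage b \<omega>" unfolding r(3) by simp
          also have "\<dots> \<le> ennreal t" using * by simp
          finally show "\<omega> \<in> ?A \<and> passage a \<omega> < \<infinity> \<and> \<theta> (enn2real (passage a \<omega>)) \<omega> \<in> ?B t"
            using * r by simp
        qed
      qed
    qed
    \<comment> \<open>Off \<open>?A\<close> the detour to \<open>a\<close> has already used up at
      least \<epsilon> of the time available for reaching \<open>b\<close>.\<close>
    have 2: "prob (?B t - ?A) \<le> prob {\<omega> \<in> space M - ?A. passage a \<omega> < \<infinity>} * measure (P (Some a)) (?B (t - \<epsilon>))"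
    proof (rule strong_Markov_le[OF E(2,1) A' passage_le_F0[OF E(3)]])
      show "AE \<omega> in P (Some x). \<omega> \<in> ?B t - ?A \<longrightarrow>
          \<omega> \<in> space M - ?A \<and> passage a \<omega> < \<infinity> \<and> \<theta> (enn2real (passage a \<omega>)) \<omega> \<in> ?B (t - \<epsilon>)"
        using shift
      proof eventually_elim
        case (elim \<omega>)
        show ?case
        proof
          assume *: "\<omega> \<in> ?B t - ?A"
          with elim obtain r where r: "r \<ge> 0" "passage a \<omega> = ennreal r"
            "passage b \<omega> = ennreal r + passage b (\<theta> r \<omega>)" "\<theta> r \<omega> \<in> space M" by blast
          have "\<not> ennreal r < ennreal \<epsilon>" using * r by simp
          then have re: "\<epsilon> \<le> r" using r(1) \<epsilon> by (simp add: ennreal_less_iff)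
          have le: "ennreal r + passage b (\<theta> r \<omega>) \<le> ennreal t" using * r by simp
          then obtain v where v: "passage b (\<theta> r \<omega>) = ennreal v" "v \<ge> 0"
            by (cases "passage b (\<theta> r \<omega>)") (auto simp: top_unique)
          have "ennreal (r + v) \<le> ennreal t" using le v r by simp
          moreover have "0 < r + v" using re \<epsilon> v by simp
          ultimately have "r + v \<le> t" by (simp add: ennreal_le_iff2)
          then have "passage b (\<theta> r \<omega>) \<le> ennreal (t - \<epsilon>)" unfolding v using re by (intro ennreal_leI) simp
          then show "\<omega> \<in> space M - ?A \<and> passage a \<omega> < \<infinity> \<and> \<theta> (enn2real (passage a \<omega>)) \<omega> \<in> ?B (t - \<epsilon>)"
            using * r by simp
        qed
      qed
    qed
    have "reach x b t = prob (?B t \<inter> ?A) + prob (?B t - ?A)"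
      unfolding reach_def using finite_measure_Diff'[OF BM[of t] AM] by simp
    also have "\<dots> \<le> p * reach a b t + 1 * reach a b (t - \<epsilon>)"
    proof (intro add_mono)
      have q: "prob {\<omega> \<in> ?A. passage a \<omega> < \<infinity>} \<le> p"
        unfolding p_def using AM by (intro finite_measure_mono) auto
      show "prob (?B t \<inter> ?A) \<le> p * reach a b t"
        unfolding reach_def by (rule order_trans[OF 1 mult_right_mono[OF q measure_nonneg]])
      show "prob (?B t - ?A) \<le> 1 * reach a b (t - \<epsilon>)"
        using 2 prob_le_1 by (auto simp: reach_def intro!: order_trans[OF 2] mult_left_le_one_le)
    qed
    \<comment> \<open>After the detour the process restarts at \<open>a\<close>, further from
      \<open>b\<close> than \<open>x\<close>; replacing \<open>a\<close> by \<open>x\<close> only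
      increases the bounds and closes the recursion.\<close>
    also have "\<dots> \<le> p * reach x b t + reach x b (t - \<epsilon>)"
      using reach_mono[OF E betw] by (intro add_mono mult_left_mono) (auto simp: p_def)
    finally show ?thesis .
  qed
  have "reach x b (real n * \<epsilon>) = 0" for n
  proof (induction n)
    case 0
    have "reach x b 0 = prob {}"
      unfolding reach_def
    proof (rule measure_eq_AE)
      show "AE \<omega> in P (Some x). (\<omega> \<in> {\<omega> \<in> space M. passage b \<omega> \<le> ennreal 0}) = (\<omega> \<in> {})"
        using AE_passage_pos[OF E(2,3) ne(2)] by eventually_elim auto
      show "{\<omega> \<in> space M. passage b \<omega> \<le> ennreal 0} \<in> sets (P (Some x))"
        using F0_sets_P[OF x passage_le_F0[OF E(3)]] .
    qed simp
    then show ?case by simp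
  next
    case (Suc n)
    have "real (Suc n) * \<epsilon> - \<epsilon> = real n * \<epsilon>" by (simp add: algebra_simps)
    then have "reach x b (real (Suc n) * \<epsilon>) \<le> p * reach x b (real (Suc n) * \<epsilon>)"
      using step[of "real (Suc n) * \<epsilon>"] Suc by simp
    then have "(1 - p) * reach x b (real (Suc n) * \<epsilon>) \<le> 0" by (simp add: algebra_simps)
    then have "reach x b (real (Suc n) * \<epsilon>) \<le> 0" using p by (simp add: mult_le_0_iff)
    then show ?case using measure_nonneg unfolding reach_def by (metis order_antisym)
  qed
  then show False using reach_pos[OF E(2,3) ne(2) \<epsilon>] by auto
qed

text \<open>Let \<open>m\<close> be the supremum over the interval of the probability of never
  leaving it. A path that has not left by time \<open>t\<close> is still at a state of the interval,
  so the Markov property at \<open>t\<close> bounds \<open>m\<close> by \<open>m\<close> times the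
  probability of staying until \<open>t\<close>. By \<open>reach_mono\<close> that factor is at most
  \<open>1 - reach a b t\<close> for all starting points, which is below 1, and hence
  \<open>m = 0\<close>.\<close>

lemma AE_exit_interval:
  assumes E: "a \<in> E" "x \<in> E" "b \<in> E" and "a < x" "x < b"
  shows "AE \<omega> in P (Some x). passage a \<omega> < \<infinity> \<or> passage b \<omega> < \<infinity>"
proof -
  have ab: "a \<noteq> b" using assms by auto
  obtain n where n: "reach a b (real n * 1) > 0" using reach_pos[OF E(1,3) ab, of 1] by auto
  define t where "t = real n"
  have t: "t \<ge> 0" and pos: "reach a b t > 0" using n by (auto simp: t_def)
  define A where "A = {\<omega> \<in> space M. \<not> passage a \<omega> \<le> ennreal t \<and> \<not> passage b \<omega> \<le> ennreal t}"
  define B where "B = {\<omega> \<in> space M. \<not> passage a \<omega> < \<infinity> \<and> \<not> passage b \<omega> < \<infinity>}"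
  note [measurable] = passage_measurable[OF E(1)] passage_measurable[OF E(3)]
  have "{\<omega> \<in> space F0. \<not> passage a \<omega> < \<infinity> \<and> \<not> passage b \<omega> < \<infinity>} \<in> sets F0" by measurable
  then have B: "B \<in> sets F0" by (simp add: B_def)
  have "{\<omega> \<in> space F0. \<not> passage a \<omega> \<le> ennreal t \<and> \<not> passage b \<omega> \<le> ennreal t} \<in> sets F0"
    by measurable
  then have A0: "A \<in> sets F0" by (simp add: A_def)
  have A: "A \<in> Ft t"
  proof -
    interpret sigma_algebra "space M" "Ft t" using Ft_sigma_algebra t .
    have "A = (space M - {\<omega> \<in> space M. passage a \<omega> \<le> ennreal t}) - {\<omega> \<in> space M. passage b \<omega> \<le> ennreal t}"
      by (auto simp: A_def)
    also have "\<dots> \<in> Ft t"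
      using passage_stopping[OF E(1)] passage_stopping[OF E(3)] t unfolding stopping_def by blast
    finally show ?thesis .
  qed
  define h where "h z = emeasure (P (Some z)) B" for z
  define I where "I = E \<inter> {a<..<b}"
  define m where "m = (SUP z\<in>I. h z)"
  have AE_A: "AE \<omega> in P (Some z). \<omega> \<in> A \<longrightarrow> (\<exists>w\<in>I. X t \<omega> = Some w)" if z: "z \<in> I" for z
  proof -
    have "AE \<omega> in P (Some z). regular z {a, b} \<omega>"
      using AE_regular[of z "{a, b}"] z E by (simp add: I_def)
    then show ?thesis
    proof eventually_elim
      case (elim \<omega>)
      show ?case
        using no_killing[OF elim, of a b t] z E t by (auto simp: A_def I_def not_le)
    qed
  qed
  have bound: "h z \<le> m * ennreal (1 - reach a b t)" if z: "z \<in> I" for z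
  proof -
    have zE: "z \<in> E" "Some z \<in> S" and bz: "betw a z b" using z by (auto simp: I_def betw_def)
    interpret prob_space "P (Some z)" using prob_P zE(1) .
    have "h z \<le> emeasure (P (Some z)) {\<omega> \<in> A. \<theta> t \<omega> \<in> B}"
      unfolding h_def
    proof (rule emeasure_mono)
      show "B \<subseteq> {\<omega> \<in> A. \<theta> t \<omega> \<in> B}"
      proof
        fix \<omega> assume "\<omega> \<in> B"
        then have \<omega>: "\<omega> \<in> space M" "passage a \<omega> = \<infinity>" "passage b \<omega> = \<infinity>"
          by (auto simp: B_def less_top[symmetric])
        then have "ennreal t + passage a (\<theta> t \<omega>) = \<infinity>" "ennreal t + passage b (\<theta> t \<omega>) = \<infinity>"
          using passage_shift[OF \<omega>(1) E(1) t] passage_shift[OF \<omega>(1) E(3) t] by auto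
        then have "passage a (\<theta> t \<omega>) = \<infinity>" "passage b (\<theta> t \<omega>) = \<infinity>"
          by (simp_all add: ennreal_add_eq_top)
        then show "\<omega> \<in> {\<omega> \<in> A. \<theta> t \<omega> \<in> B}"
          using \<omega> shift_space[OF \<omega>(1) t] by (auto simp: A_def B_def top_unique)
      qed
      show "{\<omega> \<in> A. \<theta> t \<omega> \<in> B} \<in> sets (P (Some z))"
        using strong_Markov_const(1)[OF zE(2) t A B] sets_P[OF zE(2)] by simp
    qed
    also have "\<dots> = (\<integral>\<^sup>+ \<omega>. indicator A \<omega> * emeasure (P (X t \<omega>)) B \<partial>P (Some z))"
      by (rule strong_Markov_const(2)[OF zE(2) t A B])
    also have "\<dots> \<le> (\<integral>\<^sup>+ \<omega>. m * indicator A \<omega> \<partial>P (Some z))"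
    proof (rule nn_integral_mono_AE)
      show "AE \<omega> in P (Some z). indicator A \<omega> * emeasure (P (X t \<omega>)) B \<le> m * indicator A \<omega>"
        using AE_A[OF z]
      proof eventually_elim
        case (elim \<omega>)
        show ?case
        proof (cases "\<omega> \<in> A")
          case True
          with elim obtain w where "w \<in> I" "X t \<omega> = Some w" by blast
          then show ?thesis using True unfolding m_def h_def by (auto intro: SUP_upper)
        qed auto
      qed
    qed
    also have "\<dots> = m * emeasure (P (Some z)) A"
      using F0_sets_P[OF zE(2) A0] by (rule nn_integral_cmult_indicator)
    also have "\<dots> \<le> m * ennreal (1 - reach a b t)"
    proof (rule mult_left_mono)
      let ?C = "{\<omega> \<in> space M. passage b \<omega> \<le> ennreal t}"
      have C: "?C \<in> sets (P (Some z))" using F0_sets_P[OF zE(2) passage_le_F0[OF E(3)]] .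
      have "prob A \<le> prob (space (P (Some z)) - ?C)"
        using sets.compl_sets[OF C]
        by (intro finite_measure_mono) (auto simp: A_def space_P[OF zE(2)])
      also have "\<dots> = 1 - reach z b t" unfolding reach_def using C by (rule prob_compl)
      also have "\<dots> \<le> 1 - reach a b t" using reach_mono[OF E(1) zE(1) E(3) bz] by simp
      finally show "emeasure (P (Some z)) A \<le> ennreal (1 - reach a b t)"
        unfolding emeasure_eq_measure by (rule ennreal_leI)
    qed simp
    finally show ?thesis .
  qed
  \<comment> \<open>The inequality for \<open>m\<close> forces \<open>m = 0\<close> only if
    \<open>m\<close> is finite.\<close>
  have "m \<le> 1"
    unfolding m_def h_def I_def using prob_P by (intro SUP_least prob_space.emeasure_le_1) auto
  then obtain r where r: "m = ennreal r" "r \<ge> 0" by (cases m) (auto simp: top_unique)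
  have "m \<le> m * ennreal (1 - reach a b t)"
    using bound unfolding m_def by (intro SUP_least) blast
  moreover have le1: "reach a b t \<le> 1"
    unfolding reach_def using prob_P[OF E(1)] by (simp add: prob_space.prob_le_1)
  ultimately have "r \<le> r * (1 - reach a b t)"
    using r by (simp flip: ennreal_mult)
  then have "r * reach a b t \<le> 0" by (simp add: algebra_simps)
  then have "r = 0" using pos r(2) by (simp add: mult_le_0_iff)
  then have "h x \<le> 0" using r assms SUP_upper[of x I h] by (auto simp: I_def m_def)
  then have "B \<in> null_sets (P (Some x))"
    using F0_sets_P[OF Some_in_S[OF E(2)] B] by (auto simp: h_def null_sets_def)
  then have "AE \<omega> in P (Some x). \<omega> \<notin> B" by (rule AE_not_in)
  moreover have "AE \<omega> in P (Some x). \<omega> \<in> space M"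
    using space_P[OF Some_in_S[OF E(2)]] AE_space by metis
  ultimately show ?thesis by eventually_elim (auto simp: B_def)
qed

lemma AE_exit:
  assumes "a \<in> E" "x \<in> E" "b \<in> E" "betw a x b"
  shows "AE \<omega> in P (Some x). passage a \<omega> < \<infinity> \<or> passage b \<omega> < \<infinity>"
  using assms(4) unfolding betw_def
proof (elim disjE conjE)
  assume "b < x" "x < a"
  from AE_exit_interval[OF assms(3,2,1) this] show ?thesis by (simp add: disj_commute)
qed (rule AE_exit_interval[OF assms(1-3)])

text \<open>At least one passage time is almost surely finite, and a finite one cannot equal the
  other.\<close>

lemma pass_before_complement:
  assumes E: "a \<in> E" "x \<in> E" "b \<in> E" and betw: "betw a x b"
  shows "pass_before x b a + pass_before x a b = 1"
proof -
  interpret prob_space "P (Some x)" using prob_P E(2) .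
  have x: "Some x \<in> S" using E by simp
  let ?A = "{\<omega> \<in> space M. passage b \<omega> < passage a \<omega>}" and ?B = "{\<omega> \<in> space M. passage a \<omega> < passage b \<omega>}"
  have A: "?A \<in> events" "?B \<in> events" using F0_sets_P[OF x passage_less_F0] E by auto
  have "prob ?A + prob ?B = prob (?A \<union> ?B)"
    using A by (intro finite_measure_Union[symmetric]) auto
  also have "\<dots> = 1"
  proof (rule prob_eq_1[THEN iffD2])
    show "?A \<union> ?B \<in> events" using A by blast
    have "AE \<omega> in P (Some x). regular x {a, b} \<omega>" using AE_regular[OF E(2)] E by simp
    then show "AE \<omega> in P (Some x). \<omega> \<in> ?A \<union> ?B"
      using AE_exit[OF E betw]
    proof eventually_elim
      case (elim \<omega>)
      have "passage a \<omega> \<noteq> passage b \<omega>"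
        using passage_neq[OF elim(1), of a b] passage_neq[OF elim(1), of b a] betw_neq[OF betw] elim(2) by auto
      then show ?case using regularD(1)[OF elim(1)] by auto
    qed
  qed
  finally show ?thesis unfolding pass_before_def .
qed

text \<open>The path must meet \<open>y\<close> before \<open>z\<close>. If it meets
  \<open>y\<close> before \<open>a\<close>, then restarting at \<open>y\<close> subtracts the same
  finite time from the passages of \<open>z\<close> and \<open>a\<close>, so their order is
  unchanged.\<close>

lemma pass_before_chain:
  assumes E: "a \<in> E" "x \<in> E" "y \<in> E" "z \<in> E" and betw: "betw a x y" "betw x y z"
  shows "pass_before x z a = pass_before x y a * pass_before y z a"
proof -
  interpret prob_space "P (Some x)" using prob_P E(2) .
  have x: "Some x \<in> S" using E by simp
  let ?A = "{\<omega> \<in> space M. passage y \<omega> < passage a \<omega>}" and ?B = "{\<omega> \<in> space M. passage z \<omega> < passage a \<omega>}"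
  have A: "?A \<in> stopped_sets M Ft (passage y)"
    using stopped_passage_less[OF E(3) passage_stopping[OF E(1)]] .
  have B: "?B \<in> sets F0" using passage_less_F0 E by blast
  have "pass_before x z a = prob {\<omega> \<in> ?A. passage y \<omega> < \<infinity> \<and> \<theta> (enn2real (passage y \<omega>)) \<omega> \<in> ?B}"
    unfolding pass_before_def
  proof (rule measure_eq_AE)
    have "AE \<omega> in P (Some x). regular x {a, y, z} \<omega>" using AE_regular[OF E(2)] E by simp
    then show "AE \<omega> in P (Some x). (\<omega> \<in> ?B) =
       (\<omega> \<in> {\<omega> \<in> ?A. passage y \<omega> < \<infinity> \<and> \<theta> (enn2real (passage y \<omega>)) \<omega> \<in> ?B})"
    proof eventually_elim
      case (elim \<omega>)
      have \<omega>: "\<omega> \<in> space M" using regularD(1)[OF elim] .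
      have order: "passage y \<omega> < passage z \<omega>" if "passage z \<omega> < \<infinity> \<or> passage y \<omega> < \<infinity>"
        using passage_order[OF elim, of y z] E betw that
        by (cases "passage z \<omega> < \<infinity>") (auto simp: less_top[symmetric])
      show ?case
      proof (cases "passage y \<omega> < \<infinity> \<and> passage y \<omega> < passage a \<omega>")
        case True
        then obtain r where r: "passage y \<omega> = ennreal r" "r \<ge> 0" by (cases "passage y \<omega>") auto
        have "passage a \<omega> = ennreal r + passage a (\<theta> r \<omega>)"
          using passage_shift[OF \<omega> E(1) r(2)] True r by simp
        moreover have "passage z \<omega> = ennreal r + passage z (\<theta> r \<omega>)"
          using passage_shift[OF \<omega> E(4) r(2)] order True r by simp
        ultimately have "passage z \<omega> < passage a \<omega> \<longleftrightarrow> passage z (\<theta> r \<omega>) < passage a (\<theta> r \<omega>)"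
          by (simp add: ennreal_add_left_cancel_less)
        then show ?thesis using True r \<omega> shift_space[OF \<omega> r(2)] by simp
      next
        case False
        have "\<not> passage z \<omega> < passage a \<omega>"
        proof
          assume less: "passage z \<omega> < passage a \<omega>"
          then have "passage z \<omega> < \<infinity>" by (metis infinity_ennreal_def less_top_ennreal order_less_imp_not_less top.not_eq_extremum)
          then have "passage y \<omega> < passage z \<omega>" using order by blast
          with less False \<open>passage z \<omega> < \<infinity>\<close> show False by (meson less_trans)
        qed
        with False show ?thesis by auto
      qed
    qed
    show "?B \<in> events" using F0_sets_P[OF x B] .
    show "{\<omega> \<in> ?A. passage y \<omega> < \<infinity> \<and> \<theta> (enn2real (passage y \<omega>)) \<omega> \<in> ?B} \<in> events"
      using strong_Markov_passage(1)[OF x E(3) A B] sets_P[OF x] by simp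
  qed
  also have "\<dots> = prob {\<omega> \<in> ?A. passage y \<omega> < \<infinity>} * pass_before y z a"
    unfolding pass_before_def by (rule strong_Markov_passage(2)[OF x E(3) A B])
  also have "{\<omega> \<in> ?A. passage y \<omega> < \<infinity>} = ?A"
    by (auto simp: less_top[symmetric] dest: le_less_trans[OF _ ennreal_less_top])
  finally show ?thesis unfolding pass_before_def .
qed

text \<open>On the event that \<open>T\<^sub>y\<^sub>n < T\<^sub>a\<close> for all \<open>n\<close>, the left limit at \<open>sup T\<^sub>y\<^sub>n\<close> is \<open>c\<close>, so \<open>c\<close> is hit by then.\<close>

lemma pass_before_tendsto:
  fixes y :: "nat \<Rightarrow> ereal"
  assumes E: "a \<in> E" "x \<in> E" "c \<in> E" "\<And>n. y n \<in> E" and betw: "betw a x c"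
    and y: "\<And>n. betw x (y n) c" "\<And>n. betw x (y n) (y (Suc n))" and lim: "y \<longlonglongrightarrow> c"
  shows "(\<lambda>n. pass_before x (y n) a) \<longlonglongrightarrow> pass_before x c a"
proof -
  interpret prob_space "P (Some x)" using prob_P E(2) .
  have x: "Some x \<in> S" using E by simp
  define A where "A z = {\<omega> \<in> space M. passage z \<omega> < passage a \<omega>}" for z
  have A: "A z \<in> events" if "z \<in> E" for z unfolding A_def using F0_sets_P[OF x passage_less_F0] E that by auto
  let ?Y = "insert a (insert c (range y))"
  have YE: "?Y \<subseteq> E" using E by auto
  have reg: "AE \<omega> in P (Some x). regular x ?Y \<omega>" using AE_regular[OF E(2) _ YE] by simp
  have finite_of_less: "passage z \<omega> < \<infinity>" if "passage z \<omega> < passage a \<omega>" for z \<omega>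
    using that by (metis infinity_ennreal_def not_less_iff_gr_or_eq top.not_eq_extremum top_greatest less_le_trans)
  have order: "passage u \<omega> < passage a \<omega>"
    if "regular x ?Y \<omega>" "passage v \<omega> < passage a \<omega>" "u \<in> ?Y" "v \<in> ?Y" "betw x u v" for u v \<omega>
    using passage_order[OF that(1,3,4) YE that(5) finite_of_less[OF that(2)]] that(2) by (rule less_trans)
  have dec: "\<omega> \<in> A (y i)" if "regular x ?Y \<omega>" "\<omega> \<in> A (y n)" "i \<le> n" for \<omega> i n
    using that(3,2)
  proof (induction rule: dec_induct)
    case (step n)
    then have "\<omega> \<in> A (y n)" using order[OF that(1), of "y (Suc n)" "y n"] y(2) by (auto simp: A_def)
    then show ?case using step by blast
  qed
  \<comment> \<open>The events \<open>A (y n)\<close> decrease only almost surely; the intersections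
    decrease everywhere, as continuity of the measure requires.\<close>
  define B where "B n = (\<Inter>i\<le>n. A (y i))" for n
  have B: "B n \<in> events" for n unfolding B_def using A E by (intro sets.finite_INT) auto
  have "prob (B n) = pass_before x (y n) a" for n
    unfolding pass_before_def A_def[symmetric]
  proof (rule measure_eq_AE)
    show "AE \<omega> in P (Some x). (\<omega> \<in> B n) = (\<omega> \<in> A (y n))"
      using reg by eventually_elim (auto simp: B_def intro: dec)
  qed (use B A E in auto)
  moreover have "(\<lambda>n. prob (B n)) \<longlonglongrightarrow> prob (\<Inter>n. B n)"
    using B by (intro finite_Lim_measure_decseq) (auto simp: decseq_def B_def)
  moreover have "prob (\<Inter>n. B n) = pass_before x c a"
    unfolding pass_before_def A_def[symmetric]
  proof (rule measure_eq_AE)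
    show "AE \<omega> in P (Some x). (\<omega> \<in> (\<Inter>n. B n)) = (\<omega> \<in> A c)"
      using reg AE_exit[OF E(1-3) betw]
    proof eventually_elim
      case (elim \<omega>)
      have \<omega>: "\<omega> \<in> space M" using regularD(1)[OF elim(1)] .
      show ?case
      proof
        assume "\<omega> \<in> A c"
        then have "\<omega> \<in> A (y n)" for n using order[OF elim(1), of c "y n"] y(1) by (auto simp: A_def)
        then show "\<omega> \<in> (\<Inter>n. B n)" by (auto simp: B_def)
      next
        assume "\<omega> \<in> (\<Inter>n. B n)"
        then have less: "passage (y n) \<omega> < passage a \<omega>" for n by (auto simp: B_def A_def)
        have "passage c \<omega> < passage a \<omega>"
        \<comment> \<open>If \<open>a\<close> is reached at time \<open>t\<close>, all
          \<open>y n\<close> are visited before \<open>t\<close>, hence so is every neighbourhood of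
          \<open>c\<close>. If \<open>a\<close> is never reached, the almost sure exit makes the
          passage of \<open>c\<close> finite.\<close>
        proof (cases "passage a \<omega> < \<infinity>")
          case True
          then obtain t where t: "passage a \<omega> = ennreal t" "t \<ge> 0" by (cases "passage a \<omega>") auto
          have "passage c \<omega> \<le> ennreal t"
            unfolding passage_def
          proof (rule approach_leI)
            fix G assume G: "openin (Etop E) G" "Some c \<in> G"
            obtain V where V: "open V" "Some -` G = V \<inter> E"
              using G(1) unfolding openin_Etop by (rule cem_open_trace)
            then have "c \<in> V" using G E by blast
            then have "\<forall>\<^sub>F n in sequentially. y n \<in> V" using lim V(1) by (simp add: tendsto_def)
            then obtain n where "y n \<in> V" by (auto simp: eventually_sequentially)
            then have yG: "Some (y n) \<in> G" using V E(4) by blast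
            obtain s where s: "s \<ge> 0" "passage (y n) \<omega> = ennreal s" "X s \<omega> = Some (y n)"
              using passage_attained[OF \<omega> regularD(6)[OF elim(1)] finite_of_less[OF less]] by blast
            have "s < t" using less[of n] s t by (simp add: ennreal_less_iff)
            then show "\<exists>s\<ge>0. s \<le> t \<and> X s \<omega> \<in> G" using s yG by (intro exI[of _ s]) auto
          qed (use E in simp)
          moreover have "passage a \<omega> \<noteq> passage c \<omega>"
            using passage_neq[OF elim(1), of a c] betw_neq[OF betw] True by auto
          ultimately show ?thesis using t by simp
        next
          case False
          then show ?thesis using elim(2) by (metis infinity_ennreal_def top.not_eq_extremum)
        qed
        then show "\<omega> \<in> A c" using \<omega> by (simp add: A_def)
      qed
    qed
  qed (use B A E in auto)
  ultimately show ?thesis by simp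
qed

lemma measure_hit_less:
  assumes "a \<in> E" "x \<in> E" "b \<in> E" "a \<noteq> x" "x \<noteq> b"
  shows "measure (P (Some x)) {\<omega> \<in> space M. hit X b \<omega> < hit X a \<omega>} = pass_before x b a"
  unfolding pass_before_def
proof (rule measure_eq_AE)
  show "AE \<omega> in P (Some x). (\<omega> \<in> {\<omega> \<in> space M. hit X b \<omega> < hit X a \<omega>}) =
      (\<omega> \<in> {\<omega> \<in> space M. passage b \<omega> < passage a \<omega>})"
    using AE_hit_eq[OF assms(2,1) assms(4)[symmetric]] AE_hit_eq[OF assms(2,3,5)]
    by eventually_elim simp
  show "{\<omega> \<in> space M. hit X b \<omega> < hit X a \<omega>} \<in> sets (P (Some x))"
    using hit_less_sets assms sets_P by simp
  show "{\<omega> \<in> space M. passage b \<omega> < passage a \<omega>} \<in> sets (P (Some x))"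
    using F0_sets_P[OF _ passage_less_F0] assms by simp
qed

end

section \<open>The scale function\<close>

lemma approaching_sequence:
  fixes c :: ereal
  assumes D: "D = {..<c} \<or> D = {c<..}" and acc: "\<And>V. open V \<Longrightarrow> c \<in> V \<Longrightarrow> E \<inter> V \<inter> D \<noteq> {}"
  obtains y :: "nat \<Rightarrow> ereal"
  where "\<And>n. y n \<in> E \<inter> D" "\<And>m n. m < n \<Longrightarrow> betw (y m) (y n) c" "y \<longlonglongrightarrow> c"
proof -
  obtain A where A: "\<And>n. open (A n)" "\<And>n. c \<in> A n" "decseq A"
      "\<And>G. open G \<Longrightarrow> c \<in> G \<Longrightarrow> \<exists>n::nat. A n \<subseteq> G"
    using ereal_nbh_base by blast
  have "\<exists>y. \<forall>n. (y n \<in> E \<inter> A n \<inter> D) \<and> betw (y n) (y (Suc n)) c"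
  proof (rule dependent_nat_choice)
    show "\<exists>x. x \<in> E \<inter> A 0 \<inter> D" using acc[OF A(1,2), of 0] by blast
  next
    fix v n assume v: "v \<in> E \<inter> A n \<inter> D"
    \<comment> \<open>Cutting at \<open>v\<close> makes the next point strictly closer to
      \<open>c\<close> on the same side.\<close>
    define W where "W = (if v < c then {v<..} else {..<v})"
    have "open W" "c \<in> W" using v D by (auto simp: W_def)
    then obtain w where "w \<in> E \<inter> (A (Suc n) \<inter> W) \<inter> D"
      using acc[of "A (Suc n) \<inter> W"] A(1,2) by blast
    then show "\<exists>w. w \<in> E \<inter> A (Suc n) \<inter> D \<and> betw v w c"
      using D v by (intro exI[of _ w]) (auto simp: W_def betw_def split: if_splits)
  qed
  then obtain y where y: "\<And>n. y n \<in> E \<inter> A n \<inter> D" "\<And>n. betw (y n) (y (Suc n)) c" by blast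
  show thesis
  proof
    show "y n \<in> E \<inter> D" for n using y(1)[of n] by blast
    show "betw (y m) (y n) c" if "m < n" for m n
      using that
    proof (induction n)
      case (Suc n)
      then show ?case using y(2)[of n] y(2)[of m] by (auto simp: less_Suc_eq betw_def)
    qed simp
    show "y \<longlonglongrightarrow> c"
    proof (rule topological_tendstoI)
      fix G assume "open G" "c \<in> G"
      then obtain k where "A k \<subseteq> G" using A(4) by blast
      then have "y n \<in> G" if "n \<ge> k" for n using y(1)[of n] decseqD[OF A(3) that] by blast
      then show "\<forall>\<^sub>F n in sequentially. y n \<in> G" by (auto simp: eventually_sequentially)
    qed
  qed
qed

text \<open>Fix two points \<open>a < b\<close> to determine the affine map. With the fractions
  cleared, a third point to the left, between or to the right leads to the same linear
  equation.\<close>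

lemma affine_of_cross_ratio:
  fixes s s' :: "'a::linorder \<Rightarrow> real"
  assumes mono: "strict_mono_on E s" "strict_mono_on E s'"
    and eq: "\<And>a x b. a \<in> E \<Longrightarrow> x \<in> E \<Longrightarrow> b \<in> E \<Longrightarrow> a < x \<Longrightarrow> x < b \<Longrightarrow>
      (s x - s a) / (s b - s a) = (s' x - s' a) / (s' b - s' a)"
  shows "\<exists>\<alpha>>0. \<exists>\<beta>. \<forall>x\<in>E. s' x = \<alpha> * s x + \<beta>"
proof (cases "\<exists>a\<in>E. \<exists>b\<in>E. a < b")
  case False
  then have "\<exists>c. E \<subseteq> {c}" by (metis insertI1 linorder_neqE subsetI singleton_iff)
  then obtain c where "E \<subseteq> {c}" by blast
  then show ?thesis by (intro exI[of _ 1] conjI exI[of _ "s' c - s c"]) auto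
next
  case True
  then obtain a b where ab: "a \<in> E" "b \<in> E" "a < b" by blast
  have less: "s u < s v" "s' u < s' v" if "u \<in> E" "v \<in> E" "u < v" for u v
    using mono that by (auto simp: strict_mono_on_def)
  have cross: "(s v - s u) * (s' w - s' u) = (s' v - s' u) * (s w - s u)"
    if "u \<in> E" "v \<in> E" "w \<in> E" "u < v" "v < w" for u v w
  proof -
    have "u < w" using that by simp
    then have "s w - s u \<noteq> 0" "s' w - s' u \<noteq> 0" using less[OF that(1,3)] by auto
    then show ?thesis using eq[OF that] by (simp add: frac_eq_eq)
  qed
  have line: "(s' x - s' a) * (s b - s a) = (s' b - s' a) * (s x - s a)" if x: "x \<in> E" for x
  proof -
    consider "x = a" | "x = b" | "x < a" | "a < x" "x < b" | "b < x"
      by (meson linorder_neqE)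
    then show ?thesis
    proof cases
      case 3
      from cross[OF x ab(1,2) this ab(3)] show ?thesis by (simp add: algebra_simps)
    next
      case 4
      from cross[OF ab(1) x ab(2) this] show ?thesis by (simp add: algebra_simps)
    next
      case 5
      from cross[OF ab(1,2) x ab(3) this] show ?thesis by (simp add: algebra_simps)
    qed simp_all
  qed
  define \<alpha> where "\<alpha> = (s' b - s' a) / (s b - s a)"
  have "\<alpha> > 0" using less[OF ab] by (simp add: \<alpha>_def)
  moreover have "s' x = \<alpha> * s x + (s' a - \<alpha> * s a)" if "x \<in> E" for x
  proof -
    have "s' x - s' a = \<alpha> * (s x - s a)"
      using line[OF that] less[OF ab] by (simp add: \<alpha>_def field_simps)
    then show ?thesis by (simp add: algebra_simps)
  qed
  ultimately show ?thesis by blast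
qed

context skip_free begin

section \<open>Exit probabilities on nested intervals\<close>

definition exit_ratio :: "ereal \<Rightarrow> ereal \<Rightarrow> ereal \<Rightarrow> real" where
  "exit_ratio a b x = (if x \<le> a then 0 else if b \<le> x then 1 else pass_before x b a)"

text \<open>Built into the definition, so that the relations below hold on closed intervals without
  discussing a start at an endpoint.\<close>

lemma exit_ratio_a [simp]: "exit_ratio a b a = 0" and exit_ratio_b [simp]: "a < b \<Longrightarrow> exit_ratio a b b = 1"
  by (auto simp: exit_ratio_def)

lemma exit_ratio_between: "a < x \<Longrightarrow> x < b \<Longrightarrow> exit_ratio a b x = pass_before x b a"
  by (auto simp: exit_ratio_def)

lemma exit_ratio_bounds:
  assumes "a \<in> E" "x \<in> E" "b \<in> E" "a < x" "x < b"
  shows "0 < exit_ratio a b x" "exit_ratio a b x < 1"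
proof -
  have *: "betw a x b" "betw b x a" using assms by (auto simp: betw_def)
  show "0 < exit_ratio a b x" "exit_ratio a b x < 1"
    using pass_before_pos[OF assms(1-3) *(1)] pass_before_pos[OF assms(3,2,1) *(2)] pass_before_complement[OF assms(1-3) *(1)]
    unfolding exit_ratio_between[OF assms(4,5)] by auto
qed

text \<open>To reach the farther right end before \<open>a\<close> the path first has to reach
  \<open>b\<close>; the second factor does not depend on the start.\<close>

lemma exit_ratio_extend_right:
  assumes "a \<in> E" "x \<in> E" "b \<in> E" "b' \<in> E" "a \<le> x" "x \<le> b" "a < b" "b \<le> b'"
  shows "exit_ratio a b' x = exit_ratio a b x * exit_ratio a b' b"
proof -
  consider "x = a" | "x = b" | "b = b'" | "a < x" "x < b" "b < b'" using assms by fastforce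
  then show ?thesis
  proof cases
    case 4
    then have "pass_before x b' a = pass_before x b a * pass_before b b' a"
      by (intro pass_before_chain assms) (auto simp: betw_def)
    moreover have "a < b" "x < b'" using 4 by auto
    ultimately show ?thesis using 4 by (simp add: exit_ratio_between)
  qed (use assms in auto)
qed

text \<open>The mirror image: exits at the left end are counted by complements, and the path has to
  reach \<open>a\<close> before \<open>a'\<close>.\<close>

lemma exit_ratio_extend_left:
  assumes "a' \<in> E" "a \<in> E" "x \<in> E" "b \<in> E" "a' \<le> a" "a \<le> x" "x \<le> b" "a < b"
  shows "1 - exit_ratio a' b x = (1 - exit_ratio a b x) * (1 - exit_ratio a' b a)"
proof -
  consider "x = a" | "x = b" | "a = a'" | "a' < a" "a < x" "x < b" using assms by fastforce
  then show ?thesis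
  proof cases
    case 4
    have "a' < x" "a < b" using 4 by auto
    have complement: "1 - pass_before w d c = pass_before w c d" if "c \<in> E" "w \<in> E" "d \<in> E" "betw c w d" for c w d
      using pass_before_complement[OF that] by simp
    have "betw b x a" "betw x a a'" using 4 by (auto simp: betw_def)
    then have "pass_before x a' b = pass_before x a b * pass_before a a' b" by (intro pass_before_chain assms)
    moreover have "1 - pass_before x b a' = pass_before x a' b"
      by (rule complement) (use assms 4 \<open>a' < x\<close> in \<open>auto simp: betw_def\<close>)
    moreover have "1 - pass_before x b a = pass_before x a b"
      by (rule complement) (use assms 4 in \<open>auto simp: betw_def\<close>)
    moreover have "1 - pass_before a b a' = pass_before a a' b"
      by (rule complement) (use assms 4 \<open>a < b\<close> in \<open>auto simp: betw_def\<close>)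
    moreover have "exit_ratio a' b x = pass_before x b a'" "exit_ratio a b x = pass_before x b a" "exit_ratio a' b a = pass_before a b a'"
      using 4 \<open>a' < x\<close> \<open>a < b\<close> by (auto simp: exit_ratio_between)
    ultimately show ?thesis by simp
  qed (use assms in auto)
qed

text \<open>From \<open>x\<close> the path must reach \<open>y\<close> before \<open>a\<close> to
  have a chance, and this has probability below 1.\<close>

lemma exit_ratio_mono:
  assumes "a \<in> E" "x \<in> E" "y \<in> E" "b \<in> E" "a \<le> x" "x < y" "y \<le> b"
  shows "exit_ratio a b x < exit_ratio a b y"
proof -
  have pos: "exit_ratio a b y > 0"
    using exit_ratio_bounds(1)[OF assms(1,3,4)] assms by (cases "y = b") auto
  have "exit_ratio a y x < 1"
    using exit_ratio_bounds(2)[OF assms(1,2,3)] assms by (cases "x = a") auto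
  then have "exit_ratio a y x * exit_ratio a b y < exit_ratio a b y" using pos by simp
  then show ?thesis using exit_ratio_extend_right[of a x y b] assms by simp
qed

text \<open>Extending to the left and then to the right composes two affine maps, whose coefficients
  are read off at \<open>a\<close> and \<open>b\<close>.\<close>

lemma exit_ratio_nested:
  assumes E: "a' \<in> E" "a \<in> E" "x \<in> E" "b \<in> E" "b' \<in> E"
    and "a' \<le> a" "a \<le> x" "x \<le> b" "a < b" "b \<le> b'"
  shows "exit_ratio a' b' x = exit_ratio a' b' a + exit_ratio a b x * (exit_ratio a' b' b - exit_ratio a' b' a)"
proof -
  have "exit_ratio a' b' x = exit_ratio a' b x * exit_ratio a' b' b"
    by (rule exit_ratio_extend_right) (use assms in auto)
  moreover have "exit_ratio a' b' a = exit_ratio a' b a * exit_ratio a' b' b"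
    by (rule exit_ratio_extend_right) (use assms in auto)
  moreover have "1 - exit_ratio a' b x = (1 - exit_ratio a b x) * (1 - exit_ratio a' b a)"
    by (rule exit_ratio_extend_left) (use assms in auto)
  then have "exit_ratio a' b x = exit_ratio a' b a + exit_ratio a b x * (1 - exit_ratio a' b a)" by (simp add: algebra_simps)
  ultimately show ?thesis by (simp add: algebra_simps)
qed

text \<open>Normalised to \<open>0\<close> at \<open>a0\<close> and \<open>1\<close> at
  \<open>b0\<close> for reference points \<open>a0 < b0\<close> of \<open>E\<close>. Each
  \<open>x\<close> uses the smallest interval containing it and both reference points; consistency
  between different \<open>x\<close> is \<open>scale_eq\<close>.\<close>

definition scale :: "ereal \<Rightarrow> ereal \<Rightarrow> ereal \<Rightarrow> real" where
  "scale a0 b0 x = (let v = exit_ratio (min a0 x) (max b0 x) in (v x - v a0) / (v b0 - v a0))"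

context
  fixes a0 b0 :: ereal
  assumes ab0: "a0 \<in> E" "b0 \<in> E" "a0 < b0"
begin

text \<open>Passing to a larger interval changes \<open>exit_ratio\<close> by an affine map with
  positive slope \<open>d\<close>, which cancels in the normalised quotient.\<close>

lemma scale_eq:
  assumes "a \<in> E" "b \<in> E" "x \<in> E" "a \<le> a0" "b0 \<le> b" "a \<le> x" "x \<le> b"
  shows "scale a0 b0 x = (exit_ratio a b x - exit_ratio a b a0) / (exit_ratio a b b0 - exit_ratio a b a0)"
proof -
  define A B where "A = min a0 x" and "B = max b0 x"
  have AB: "A \<in> E" "B \<in> E" "a \<le> A" "B \<le> b" "A < B" "A \<le> a0" "A \<le> x" "b0 \<le> B" "x \<le> B"
    using assms ab0 by (auto simp: A_def B_def min_def max_def)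
  define d where "d = exit_ratio a b B - exit_ratio a b A"
  have d: "d > 0" unfolding d_def using exit_ratio_mono[OF assms(1) AB(1,2) assms(2)] AB by simp
  have nest: "exit_ratio a b y = exit_ratio a b A + exit_ratio A B y * d" if "y \<in> E" "A \<le> y" "y \<le> B" for y
    unfolding d_def by (rule exit_ratio_nested) (use that AB assms in auto)
  have "a0 \<le> B" "A \<le> b0" using AB ab0 by (auto intro: order_trans less_imp_le)
  then have "exit_ratio a b x - exit_ratio a b a0 = (exit_ratio A B x - exit_ratio A B a0) * d" "exit_ratio a b b0 - exit_ratio a b a0 = (exit_ratio A B b0 - exit_ratio A B a0) * d"
    using nest[of x] nest[of a0] nest[of b0] AB assms ab0 by (auto simp: algebra_simps)
  then show ?thesis using d unfolding scale_def by (simp add: Let_def A_def B_def)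
qed

text \<open>Provides one interval on which all points under comparison are represented by a single
  \<open>exit_ratio\<close>.\<close>

lemma scale_affine:
  assumes "a \<in> E" "b \<in> E" "a < b"
  obtains a' b' k l where "a' \<in> E" "b' \<in> E" "a' \<le> a" "b \<le> b'" "l > 0"
    "\<And>x. x \<in> E \<Longrightarrow> a' \<le> x \<Longrightarrow> x \<le> b' \<Longrightarrow> scale a0 b0 x = (exit_ratio a' b' x - k) / l"
proof -
  define a' b' where "a' = min a a0" and "b' = max b b0"
  have E: "a' \<in> E" "b' \<in> E" "a' \<le> a" "b \<le> b'" "a' \<le> a0" "b0 \<le> b'"
    using assms ab0 by (auto simp: a'_def b'_def min_def max_def)
  have "exit_ratio a' b' a0 < exit_ratio a' b' b0" using E ab0 by (intro exit_ratio_mono) auto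
  then show thesis
    using scale_eq[OF E(1,2) _ E(5,6)] E by (intro that[of a' b' "exit_ratio a' b' b0 - exit_ratio a' b' a0" "exit_ratio a' b' a0"]) auto
qed

lemma scale_strict_mono: "strict_mono_on E (scale a0 b0)"
proof (rule strict_mono_onI)
  fix x y assume xy: "x \<in> E" "y \<in> E" "x < y"
  then obtain a' b' k l where *: "a' \<in> E" "b' \<in> E" "a' \<le> x" "y \<le> b'" "l > 0"
    "\<And>x. x \<in> E \<Longrightarrow> a' \<le> x \<Longrightarrow> x \<le> b' \<Longrightarrow> scale a0 b0 x = (exit_ratio a' b' x - k) / l"
    using scale_affine by metis
  have "exit_ratio a' b' x < exit_ratio a' b' y" using * xy by (intro exit_ratio_mono) auto
  then show "scale a0 b0 x < scale a0 b0 y"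
    using * xy by (auto simp: divide_strict_right_mono)
qed

lemma scale_less: "x \<in> E \<Longrightarrow> y \<in> E \<Longrightarrow> x < y \<Longrightarrow> scale a0 b0 x < scale a0 b0 y"
  using scale_strict_mono by (auto simp: strict_mono_on_def)

lemma pass_before_interval:
  assumes E: "a \<in> E" "x \<in> E" "b \<in> E" and "a < x" "x < b"
  shows "pass_before x b a = (scale a0 b0 x - scale a0 b0 a) / (scale a0 b0 b - scale a0 b0 a)"
proof -
  have "a < b" using assms by simp
  then obtain a' b' k l where *: "a' \<in> E" "b' \<in> E" "a' \<le> a" "b \<le> b'" "l > 0"
    "\<And>x. x \<in> E \<Longrightarrow> a' \<le> x \<Longrightarrow> x \<le> b' \<Longrightarrow> scale a0 b0 x = (exit_ratio a' b' x - k) / l"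
    using scale_affine E by metis
  have "exit_ratio a' b' x = exit_ratio a' b' a + exit_ratio a b x * (exit_ratio a' b' b - exit_ratio a' b' a)"
    by (rule exit_ratio_nested) (use assms * in auto)
  moreover have "exit_ratio a b x = pass_before x b a" using assms by (simp add: exit_ratio_between)
  moreover have "exit_ratio a' b' a < exit_ratio a' b' b" using assms * by (intro exit_ratio_mono) auto
  moreover have "scale a0 b0 x - scale a0 b0 a = (exit_ratio a' b' x - exit_ratio a' b' a) / l"
    "scale a0 b0 b - scale a0 b0 a = (exit_ratio a' b' b - exit_ratio a' b' a) / l"
    using *(3-6) assms by (auto simp: diff_divide_distrib)
  ultimately show ?thesis using *(5) by simp
qed

text \<open>Reversing the order replaces the quotient by its complement with \<open>a\<close> and
  \<open>b\<close> exchanged, which is the same expression.\<close>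

lemma pass_before_betw:
  assumes E: "a \<in> E" "x \<in> E" "b \<in> E" and betw: "betw a x b"
  shows "pass_before x b a = (scale a0 b0 x - scale a0 b0 a) / (scale a0 b0 b - scale a0 b0 a)"
proof (cases "a < x")
  case True
  then show ?thesis using betw by (intro pass_before_interval E) (auto simp: betw_def)
next
  case False
  then have *: "b < x" "x < a" using betw by (auto simp: betw_def)
  have "scale a0 b0 b < scale a0 b0 a" using * E by (intro scale_less) auto
  then show ?thesis
    using pass_before_complement[OF E betw] pass_before_interval[OF E(3,2,1) *] by (simp add: field_simps)
qed

lemma scale_tendsto:
  fixes y :: "nat \<Rightarrow> ereal"
  assumes "c \<in> E" "\<And>n. y n \<in> E" "\<And>m n. m < n \<Longrightarrow> betw (y m) (y n) c" "y \<longlonglongrightarrow> c"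
  shows "(\<lambda>n. scale a0 b0 (y n)) \<longlonglongrightarrow> scale a0 b0 c"
proof -
  let ?s = "scale a0 b0"
  \<comment> \<open>The first two points of the sequence serve as fixed target and fixed start; only
    the other target \<open>z n\<close> moves towards \<open>c\<close>.\<close>
  define a x z where "a = y 0" and "x = y 1" and "z n = y (n + 2)" for n
  have E: "a \<in> E" "x \<in> E" "z n \<in> E" for n using assms by (auto simp: a_def x_def z_def)
  have betw: "betw a x c" unfolding a_def x_def by (rule assms(3)) simp
  have z1: "betw x (z n) c" for n unfolding z_def x_def by (rule assms(3)) simp
  have z2: "betw a x (z n)" for n using z1[of n] betw by (auto simp: betw_def)
  have "betw x (z n) (z (Suc n))" for n
    using z1[of n] assms(3)[of "n + 2" "Suc n + 2"] by (auto simp: z_def betw_def)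
  then have lim: "(\<lambda>n. pass_before x (z n) a) \<longlonglongrightarrow> pass_before x c a"
    using LIMSEQ_ignore_initial_segment[OF assms(4), of 2] z1 betw E assms(1) unfolding z_def
    by (intro pass_before_tendsto) auto
  have sep: "?s v \<noteq> ?s w" if "v \<in> E" "w \<in> E" "v \<noteq> w" for v w
    using scale_less[of v w] scale_less[of w v] that by (cases v w rule: linorder_cases) auto
  \<comment> \<open>The passage formula solved for the scale at the moving target. Continuity in
    that target then follows from \<open>pass_before_tendsto\<close>, the limit in the denominator
    being positive.\<close>
  have eq: "?s w = ?s a + (?s x - ?s a) / pass_before x w a" if "w \<in> E" "betw a x w" for w
  proof -
    have "?s x - ?s a = pass_before x w a * (?s w - ?s a)"
      using pass_before_betw[OF E(1,2) that] sep[OF E(1) that(1)] betw_neq[OF that(2)] by (simp add: field_simps)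
    moreover have "pass_before x w a \<noteq> 0" using pass_before_pos[OF E(1,2) that] by simp
    ultimately show ?thesis by simp
  qed
  have "pass_before x c a \<noteq> 0" using pass_before_pos[OF E(1,2) assms(1) betw] by simp
  then have "(\<lambda>n. ?s a + (?s x - ?s a) / pass_before x (z n) a) \<longlonglongrightarrow> ?s a + (?s x - ?s a) / pass_before x c a"
    using lim by (intro tendsto_intros)
  then have "(\<lambda>n. ?s (z n)) \<longlonglongrightarrow> ?s c" using eq E z2 betw assms(1) by simp
  then show ?thesis unfolding z_def by (rule LIMSEQ_offset)
qed

text \<open>If \<open>E\<close> accumulates at \<open>c\<close> from this side, one point with scale
  within \<epsilon> of that of \<open>c\<close> suffices: monotonicity controls all states between
  it and \<open>c\<close>. Otherwise a neighbourhood without states on this side does.\<close>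

lemma scale_one_sided:
  assumes c: "c \<in> E" and D: "D = {..<c} \<or> D = {c<..}" and "\<epsilon> > 0"
  obtains V where "open V" "c \<in> V" "\<And>x. x \<in> E \<inter> V \<inter> D \<Longrightarrow> \<bar>scale a0 b0 x - scale a0 b0 c\<bar> < \<epsilon>"
proof (cases "\<exists>V. open V \<and> c \<in> V \<and> E \<inter> V \<inter> D = {}")
  case True
  then show thesis using that by blast
next
  case False
  then obtain y :: "nat \<Rightarrow> ereal" where y: "\<And>n. y n \<in> E \<inter> D" "\<And>m n. m < n \<Longrightarrow> betw (y m) (y n) c" "y \<longlonglongrightarrow> c"
    using approaching_sequence[OF D, of E] by metis
  have "(\<lambda>n. scale a0 b0 (y n)) \<longlonglongrightarrow> scale a0 b0 c"
    using y by (intro scale_tendsto c) auto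
  then obtain n where n: "\<bar>scale a0 b0 (y n) - scale a0 b0 c\<bar> < \<epsilon>"
    using LIMSEQ_D[of _ _ \<epsilon>] \<open>\<epsilon> > 0\<close> by (metis order_refl real_norm_def)
  define V where "V = (if y n < c then {y n<..} else {..<y n})"
  show thesis
  proof
    show "open V" "c \<in> V" using y(1)[of n] D by (auto simp: V_def)
    fix x assume x: "x \<in> E \<inter> V \<inter> D"
    consider "y n < x" "x < c" | "c < x" "x < y n"
      using x y(1)[of n] D by (auto simp: V_def split: if_splits)
    then show "\<bar>scale a0 b0 x - scale a0 b0 c\<bar> < \<epsilon>"
    proof cases
      case 1
      then show ?thesis using n x y(1)[of n] c scale_less[of "y n" x] scale_less[of x c] by auto
    next
      case 2
      then show ?thesis using n x y(1)[of n] c scale_less[of c x] scale_less[of x "y n"] by auto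
    qed
  qed
qed

lemma scale_continuous: "continuous_on E (scale a0 b0)"
  unfolding continuous_on
proof (intro ballI tendstoI)
  fix c and \<epsilon> :: real assume c: "c \<in> E" and e: "\<epsilon> > 0"
  obtain V where V: "open V" "c \<in> V" "\<And>x. x \<in> E \<inter> V \<inter> {..<c} \<Longrightarrow> \<bar>scale a0 b0 x - scale a0 b0 c\<bar> < \<epsilon>"
    using scale_one_sided[OF c _ e, of "{..<c}"] by blast
  obtain W where W: "open W" "c \<in> W" "\<And>x. x \<in> E \<inter> W \<inter> {c<..} \<Longrightarrow> \<bar>scale a0 b0 x - scale a0 b0 c\<bar> < \<epsilon>"
    using scale_one_sided[OF c _ e, of "{c<..}"] by blast
  have "dist (scale a0 b0 x) (scale a0 b0 c) < \<epsilon>" if "x \<in> V \<inter> W" "x \<noteq> c" "x \<in> E" for x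
    using that V(3)[of x] W(3)[of x] by (cases "x < c") (auto simp: dist_real_def)
  then show "\<forall>\<^sub>F x in at c within E. dist (scale a0 b0 x) (scale a0 b0 c) < \<epsilon>"
    unfolding eventually_at_topological using V W by (intro exI[of _ "V \<inter> W"]) auto
qed

lemma is_scale_scale: "is_scale E M P X (scale a0 b0)"
  unfolding is_scale_def
proof (intro conjI ballI impI scale_continuous scale_strict_mono)
  fix a x b assume "a \<in> E" "x \<in> E" "b \<in> E" "a < x \<and> x < b"
  then show "measure (P (Some x)) {\<omega> \<in> space M. hit X b \<omega> < hit X a \<omega>} =
      (scale a0 b0 x - scale a0 b0 a) / (scale a0 b0 b - scale a0 b0 a)"
    using pass_before_interval[of a x b] measure_hit_less[of a x b] by auto
qed

end

lemma is_scale_exists: "\<exists>s. is_scale E M P X s"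
proof (cases "\<exists>a\<in>E. \<exists>b\<in>E. a < b")
  case True
  then show ?thesis using is_scale_scale by blast
next
  case False
  \<comment> \<open>With at most one state, strict monotonicity and the passage formula are
    vacuous.\<close>
  then have "is_scale E M P X (\<lambda>_. 0)"
    unfolding is_scale_def by (auto simp: strict_mono_on_def)
  then show ?thesis by blast
qed

end

theorem theorem4p5:
  fixes E :: "ereal set" and M :: "'w measure" and P :: "ereal option \<Rightarrow> 'w measure"
    and X :: "real \<Rightarrow> 'w \<Rightarrow> ereal option" and \<theta> :: "real \<Rightarrow> 'w \<Rightarrow> 'w"
    and Ft :: "real \<Rightarrow> 'w set set"
  assumes "closed (E \<union> {Inf E, Sup E})"
    and "skip_free_Hunt E M P X \<theta> Ft"
  shows "(\<exists>s. is_scale E M P X s) \<and>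
         (\<forall>s s'. is_scale E M P X s \<longrightarrow> is_scale E M P X s' \<longrightarrow>
            (\<exists>\<alpha>>0. \<exists>\<beta>. \<forall>x \<in> E. s' x = \<alpha> * s x + \<beta>))"
proof (intro conjI allI impI)
  interpret skip_free E M P X \<theta> Ft
    using assms(2) by unfold_locales (auto simp: skip_free_Hunt_def)
  show "\<exists>s. is_scale E M P X s" by (rule is_scale_exists)
  fix s s' assume "is_scale E M P X s" "is_scale E M P X s'"
  then show "\<exists>\<alpha>>0. \<exists>\<beta>. \<forall>x\<in>E. s' x = \<alpha> * s x + \<beta>"
    \<comment> \<open>Both quotients equal the same hitting probability.\<close>
    by (intro affine_of_cross_ratio) (auto simp: is_scale_def)
qed

end
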